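(* Let $n\ge1$ be an integer, and let $C_n(q)$ and $P_n(q)=C_n(q)/(q-1)^2$ be as defined below. (a) $C_n(-1)=r(n)$ and $P_n(-1)=r(n)/4$. (b) With $j=e^{2\pi i/3}$: $C_n(j)=-3\lambda(n)j^n$ and $P_n(j)=\lambda(n)j^{n-1}$. (c) With $\mathbf{i}=\sqrt{-1}$: $C_n(\mathbf{i})=(-1)^{\lfloor (n+1)/2\rfloor}r'(n)\,\mathbf{i}^n$ and $P_n(\mathbf{i})=(-1)^{\lfloor (n-1)/2\rfloor}\frac{r'(n)}{2}\,\mathbf{i}^{n-1}$. (d) With $-j=e^{\pi i/3}$: $$C_n(-j)=\begin{cases} r(n) & \text{if } n\equiv 0 \pmod 3,\\ \frac{r(n)}{4}\,j & \text{if } n\equiv 1\pmod 3,\\ -\frac{r(n)}{2}\,j^2 & \text{if } n\equiv 2\pmod 3,\end{cases}$$ and $P_n(-j)=C_n(-j)/j=C_n(-j)\,j^2$.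
   Context: For each integer $n\ge1$, the Laurent polynomial $C_n(q)$ is defined by the identity of formal power series in $t$ $$1+\sum_{n\ge1}\frac{C_n(q)}{q^n}t^n=\prod_{i\ge1}\frac{(1-t^i)^2}{1-(q+q^{-1})t^i+t^{2i}};$$ it is a polynomial in $q$ with integer coefficients divisible by $(q-1)^2$, and $P_n(q)=C_n(q)/(q-1)^2$. $r(n)$ denotes the number of pairs $(x,y)\in\mathbb{Z}^2$ with $x^2+y^2=n$; $r'(n)$ denotes the number of pairs $(x,y)\in\mathbb{Z}^2$ with $x^2+2y^2=n$. $\lambda$ is the multiplicative arithmetic function (i.e. $\lambda(mn)=\lambda(m)\lambda(n)$ for coprime $m,n$, $\lambda(1)=1$) defined on prime powers $p^e$ ($e\ge1$) by $\lambda(3^e)=-2$; $\lambda(p^e)=e+1$ if $p\equiv1\pmod 6$; $\lambda(p^e)=(1+(-1)^e)/2$ if $p\equiv 2,5\pmod 6$. For real $\alpha$, $\lfloor\alpha\rfloor$ is the largest integer $\le\alpha$. *)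

theory Defs
  imports
    "HOL-Analysis.Analysis"
    "HOL-Computational_Algebra.Computational_Algebra"
begin

unbundle no vec_syntax
unbundle fps_syntax

text \<open>
  Laurent polynomials in \<open>q\<close> are viewed inside the field of fractions of \<open>\<int>[q]\<close>, so that the
  defining identity is literally an identity of formal power series in \<open>t = fps_X\<close> over that
  field.  The infinite product is the library one (convergence in the \<open>t\<close>-adic topology);
  its index starts at \<open>0\<close>, whence \<open>Suc i\<close>.
\<close>

definition qvar :: "int poly fract" where
  "qvar = to_fract [:0, 1:]"

definition C_factor :: "nat \<Rightarrow> int poly fract fps" where
  "C_factor i = (1 - fps_X ^ i)\<^sup>2 /
     (1 - fps_const (qvar + inverse qvar) * fps_X ^ i + fps_X ^ (2 * i))"

definition C_poly :: "nat \<Rightarrow> int poly" where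
  "C_poly n = (THE p. to_fract p / qvar ^ n = (\<Prod>i. C_factor (Suc i)) $ n)"

text \<open>The division is exact for \<open>n \<ge> 1\<close>, see \<open>P_poly_mult\<close> below.\<close>

definition P_poly :: "nat \<Rightarrow> int poly" where
  "P_poly n = C_poly n div [:-1, 1:]\<^sup>2"

definition C_at :: "nat \<Rightarrow> complex \<Rightarrow> complex" where
  "C_at n z = poly (map_poly of_int (C_poly n)) z"

definition P_at :: "nat \<Rightarrow> complex \<Rightarrow> complex" where
  "P_at n z = poly (map_poly of_int (P_poly n)) z"

definition r_count :: "nat \<Rightarrow> nat" where
  "r_count n = card {(x :: int, y :: int). x\<^sup>2 + y\<^sup>2 = int n}"

definition r'_count :: "nat \<Rightarrow> nat" where
  "r'_count n = card {(x :: int, y :: int). x\<^sup>2 + 2 * y\<^sup>2 = int n}"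

definition lambda_pp :: "nat \<Rightarrow> nat \<Rightarrow> int" where
  "lambda_pp p e =
     (if p = 3 then -2
      else if p mod 6 = 1 then int e + 1
      else (1 + (-1) ^ e) div 2)"

definition lambda :: "nat \<Rightarrow> int" where
  "lambda n = (\<Prod>p\<in>prime_factors n. lambda_pp p (multiplicity p n))"


subsection \<open>Well-definedness\<close>

lemma qvar_nonzero [simp]: "qvar \<noteq> 0"
  by (simp add: qvar_def)

definition integral_fps :: "int poly fract fps \<Rightarrow> bool" where
  "integral_fps A \<longleftrightarrow> (\<forall>n. A $ n * qvar ^ n \<in> range to_fract)"

lemma range_to_fract_closed:
  fixes x y :: "int poly fract"
  shows "(0 :: int poly fract) \<in> range to_fract" "(1 :: int poly fract) \<in> range to_fract"
    and "x \<in> range to_fract \<Longrightarrow> y \<in> range to_fract \<Longrightarrow> x + y \<in> range to_fract"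
    and "x \<in> range to_fract \<Longrightarrow> y \<in> range to_fract \<Longrightarrow> x * y \<in> range to_fract"
    and "x \<in> range to_fract \<Longrightarrow> - x \<in> range to_fract"
proof -
  show "(0 :: int poly fract) \<in> range to_fract" "(1 :: int poly fract) \<in> range to_fract"
    by (metis rangeI to_fract_0, metis rangeI to_fract_1)
  assume "x \<in> range to_fract"
  then obtain a where a: "x = to_fract a" by (rule rangeE)
  show "- x \<in> range to_fract" unfolding a to_fract_uminus[symmetric] by (rule rangeI)
  assume "y \<in> range to_fract"
  then obtain b where b: "y = to_fract b" by (rule rangeE)
  show "x + y \<in> range to_fract" unfolding a b to_fract_add[symmetric] by (rule rangeI)
  show "x * y \<in> range to_fract" unfolding a b to_fract_mult[symmetric] by (rule rangeI)
qed

lemma range_to_fract_power: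
  fixes x :: "int poly fract"
  shows "x \<in> range to_fract \<Longrightarrow> x ^ n \<in> range to_fract"
  by (induction n) (simp_all only: power_0 power_Suc range_to_fract_closed)

lemma range_to_fract_sum:
  fixes f :: "'a \<Rightarrow> int poly fract"
  shows "(\<And>x. x \<in> S \<Longrightarrow> f x \<in> range to_fract) \<Longrightarrow> sum f S \<in> range to_fract"
  by (induction S rule: infinite_finite_induct)
     (simp_all only: sum.infinite sum.empty sum.insert insert_iff simp_thms range_to_fract_closed)

lemma qvar_in_range: "qvar \<in> range to_fract"
  by (simp add: qvar_def)

lemma integral_fps_add: "integral_fps A \<Longrightarrow> integral_fps B \<Longrightarrow> integral_fps (A + B)"
  unfolding integral_fps_def fps_add_nth ring_distribs
  using range_to_fract_closed(3) by blast

lemma integral_fps_const: "c \<in> range to_fract \<Longrightarrow> integral_fps (fps_const c)"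
  unfolding integral_fps_def using range_to_fract_closed(1) by simp

lemma integral_fps_mult:
  assumes "integral_fps A" "integral_fps B"
  shows "integral_fps (A * B)"
  unfolding integral_fps_def
proof
  fix n
  have "(A * B) $ n * qvar ^ n = (\<Sum>i=0..n. (A $ i * qvar ^ i) * (B $ (n - i) * qvar ^ (n - i)))"
    unfolding fps_mult_nth sum_distrib_right
    by (intro sum.cong) (auto simp flip: power_add simp: mult_ac)
  also have "\<dots> \<in> range to_fract"
    using assms by (intro range_to_fract_sum range_to_fract_closed(4)[of "_ * _" "_ * _"])
       (auto simp: integral_fps_def)
  finally show "(A * B) $ n * qvar ^ n \<in> range to_fract" .
qed

lemma integral_fps_inverse:
  assumes A: "integral_fps A" "A $ 0 = 1"
  shows "integral_fps (inverse A)"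
proof -
  have "inverse A $ n * qvar ^ n \<in> range to_fract" for n
  proof (induction n rule: less_induct)
    case (less n)
    show ?case
    proof (cases "n = 0")
      case True
      then show ?thesis using A by (auto intro: range_to_fract_closed)
    next
      case False
      have "A * inverse A = 1" using A by (simp add: inverse_mult_eq_1')
      then have "(A * inverse A) $ n = 0" using False by simp
      then have "(\<Sum>i=0..n. A $ i * inverse A $ (n - i)) = 0" by (simp add: fps_mult_nth)
      then have "inverse A $ n = - (\<Sum>i=1..n. A $ i * inverse A $ (n - i))"
        using A by (simp add: sum.atLeast_Suc_atMost eq_neg_iff_add_eq_0)
      then have "inverse A $ n * qvar ^ n =
          - (\<Sum>i=1..n. (A $ i * qvar ^ i) * (inverse A $ (n - i) * qvar ^ (n - i)))"
      proof -
        have "(A $ i * qvar ^ i) * (inverse A $ (n - i) * qvar ^ (n - i)) =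
              A $ i * inverse A $ (n - i) * qvar ^ n" if "i \<in> {1..n}" for i
        proof -
          have "qvar ^ n = qvar ^ i * qvar ^ (n - i)"
            using that by (simp flip: power_add)
          then show ?thesis by (simp only: mult_ac)
        qed
        then have "(\<Sum>i=1..n. (A $ i * qvar ^ i) * (inverse A $ (n - i) * qvar ^ (n - i))) =
                   (\<Sum>i=1..n. A $ i * inverse A $ (n - i)) * qvar ^ n"
          unfolding sum_distrib_right by (intro sum.cong) auto
        then show ?thesis
          using \<open>inverse A $ n = _\<close> by simp
      qed
      also have "\<dots> \<in> range to_fract"
        using A less
        by (intro range_to_fract_sum range_to_fract_closed(5)
              range_to_fract_closed(4)[of "_ * _" "_ * _"]) (auto simp: integral_fps_def)
      finally show ?thesis .
    qed
  qed
  then show ?thesis by (simp add: integral_fps_def)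
qed

definition C_like :: "int poly fract fps \<Rightarrow> bool" where
  "C_like A \<longleftrightarrow> (\<exists>B. integral_fps B \<and> B $ 0 = 0 \<and> A = 1 + fps_const ((qvar - 1)\<^sup>2) * B)"

lemma q1_in_range: "(qvar - 1)\<^sup>2 \<in> range to_fract"
  using range_to_fract_closed(3)[OF qvar_in_range range_to_fract_closed(5)[OF range_to_fract_closed(2)]]
  by (intro range_to_fract_power) simp

lemma C_like_1: "C_like 1"
  unfolding C_like_def
  by (intro exI[of _ 0]) (use range_to_fract_closed(1) in \<open>simp add: integral_fps_def\<close>)

lemma C_like_mult:
  assumes "C_like A" "C_like A'"
  shows "C_like (A * A')"
proof -
  obtain B B' where B: "integral_fps B" "B $ 0 = 0" "A = 1 + fps_const ((qvar - 1)\<^sup>2) * B"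
    and B': "integral_fps B'" "B' $ 0 = 0" "A' = 1 + fps_const ((qvar - 1)\<^sup>2) * B'"
    using assms unfolding C_like_def by blast
  define c where "c = fps_const ((qvar - 1)\<^sup>2)"
  have *: "(1 + d * X) * (1 + d * Y) = 1 + d * (X + Y + d * (X * Y))"
    for d X Y :: "int poly fract fps"
    by (simp add: algebra_simps)
  have c: "integral_fps c"
    unfolding c_def by (rule integral_fps_const[OF q1_in_range])
  have "A * A' = 1 + c * (B + B' + c * (B * B'))"
    unfolding B(3) B'(3) c_def by (rule *)
  moreover have "integral_fps (B + B' + c * (B * B'))"
    by (intro integral_fps_add integral_fps_mult c B B')
  moreover have "(B + B' + c * (B * B')) $ 0 = 0"
    using B(2) B'(2) by simp
  ultimately show ?thesis
    unfolding C_like_def c_def by blast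
qed

lemma C_like_factor:
  assumes i: "i \<ge> 1"
  shows "C_like (C_factor i)"
    and "n < i \<Longrightarrow> C_factor i $ n = (if n = 0 then 1 else 0)"
proof -
  define D :: "int poly fract fps" where
    "D = 1 - fps_const (qvar + inverse qvar) * fps_X ^ i + fps_X ^ (2 * i)"
  define B where "B = fps_const (inverse qvar) * fps_X ^ i * inverse D"
  have D0: "D $ 0 = 1" using i by (simp add: D_def)
  have c: "(qvar - 1)\<^sup>2 * inverse qvar = qvar + inverse qvar - 2"
  proof -
    have "(qvar - 1)\<^sup>2 * inverse qvar = (qvar * qvar + 1 - 2 * qvar) * inverse qvar"
      by (simp add: power2_eq_square algebra_simps)
    also have "\<dots> = qvar * (qvar * inverse qvar) + inverse qvar - 2 * (qvar * inverse qvar)"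
      by (simp only: ring_distribs mult_1 mult.assoc)
    finally show ?thesis by simp
  qed
  have num: "(1 - fps_X ^ i)\<^sup>2 = D + fps_const ((qvar - 1)\<^sup>2 * inverse qvar) * fps_X ^ i"
  proof -
    have *: "(1 - x)\<^sup>2 = 1 - a * x + x * x + (a - 2) * x" for a x :: "int poly fract fps"
      by (simp add: power2_eq_square algebra_simps)
    have "fps_const (qvar + inverse qvar - 2) = fps_const (qvar + inverse qvar) - 2"
      by (simp only: fps_const_sub[symmetric] numeral_fps_const)
    then show ?thesis
      unfolding c D_def mult_2 power_add by (simp only: *)
  qed
  have eq: "C_factor i = 1 + fps_const ((qvar - 1)\<^sup>2) * B"
  proof -
    have "C_factor i = (D + fps_const ((qvar - 1)\<^sup>2 * inverse qvar) * fps_X ^ i) * inverse D"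
      unfolding C_factor_def num using D0 by (simp add: fps_divide_unit flip: D_def)
    also have "\<dots> = D * inverse D + fps_const ((qvar - 1)\<^sup>2) * B"
      unfolding B_def fps_const_mult[symmetric] by (simp only: ring_distribs mult_ac)
    finally show ?thesis using D0 by (simp add: inverse_mult_eq_1')
  qed
  have qq: "inverse qvar * qvar ^ i \<in> range to_fract"
  proof -
    have "inverse qvar * qvar ^ i = qvar ^ (i - 1)"
      using i by (cases i) (auto simp: field_simps)
    then show ?thesis by (simp add: range_to_fract_power qvar_in_range)
  qed
  have X: "integral_fps (fps_const c * fps_X ^ k)" if "c * qvar ^ k \<in> range to_fract" for c k
    unfolding integral_fps_def fps_mult_left_const_nth fps_X_power_nth
    using that by (auto intro: range_to_fract_closed)
  have "integral_fps D"
  proof -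
    have "D = fps_const 1 + fps_const (- (qvar + inverse qvar)) * fps_X ^ i
               + fps_const 1 * fps_X ^ (2 * i)"
      by (simp only: D_def fps_const_neg[symmetric] fps_const_1_eq_1 mult_1 mult_minus_left
            diff_conv_add_uminus)
    moreover have "- (qvar + inverse qvar) * qvar ^ i \<in> range to_fract"
      using range_to_fract_closed(5)[OF range_to_fract_closed(3)[OF
              range_to_fract_closed(4)[OF qvar_in_range range_to_fract_power[OF qvar_in_range]] qq]]
      by (simp add: algebra_simps)
    moreover have "1 * qvar ^ (2 * i) \<in> range to_fract"
      unfolding mult_1 by (rule range_to_fract_power[OF qvar_in_range])
    ultimately show ?thesis
      by (metis integral_fps_add X integral_fps_const range_to_fract_closed(2))
  qed
  then have "integral_fps B"
    unfolding B_def using D0 qq by (intro integral_fps_mult X integral_fps_inverse) auto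
  moreover have B0: "B $ m = 0" if "m < i" for m
    unfolding B_def mult.assoc fps_mult_left_const_nth using that
    by (simp add: fps_X_power_mult_nth)
  ultimately show "C_like (C_factor i)"
    unfolding C_like_def using eq i by (intro exI[of _ B]) auto
  show "C_factor i $ n = (if n = 0 then 1 else 0)" if "n < i"
    unfolding eq using B0[OF that] by simp
qed

lemma C_like_nth_0: "C_like A \<Longrightarrow> A $ 0 = 1"
  unfolding C_like_def by (elim exE conjE) simp

lemma C_like_nth:
  assumes "C_like A" "n \<ge> 1"
  shows "\<exists>p. A $ n = to_fract ([:-1, 1:]\<^sup>2 * p) / qvar ^ n"
proof -
  from assms(1) obtain B where B: "integral_fps B" "A = 1 + fps_const ((qvar - 1)\<^sup>2) * B"
    unfolding C_like_def by blast
  obtain p where p: "B $ n * qvar ^ n = to_fract p"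
    using B(1) unfolding integral_fps_def by blast
  have q1: "to_fract [:-1, 1:] = qvar - 1"
    unfolding qvar_def to_fract_1[symmetric] to_fract_diff[symmetric] by (simp add: one_pCons)
  have "A $ n = (qvar - 1)\<^sup>2 * B $ n" using B assms(2) by simp
  also have "\<dots> = to_fract ([:-1, 1:]\<^sup>2 * p) / qvar ^ n"
    unfolding power2_eq_square to_fract_mult q1 p[symmetric] by simp
  finally show ?thesis by blast
qed

lemma C_like_prod: "C_like (\<Prod>i\<le>N. C_factor (Suc i))"
  by (induction N) (simp_all add: C_like_mult C_like_factor(1))

lemma partial_prod_stable:
  assumes "n \<le> N"
  shows "(\<Prod>i\<le>N. C_factor (Suc i)) $ n = (\<Prod>i\<le>n. C_factor (Suc i)) $ n"
  using assms
proof (induction N rule: dec_induct)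
  case (step N)
  have "((\<Prod>i\<le>N. C_factor (Suc i)) * C_factor (Suc (Suc N))) $ n =
        (\<Sum>k=0..n. (\<Prod>i\<le>N. C_factor (Suc i)) $ k * C_factor (Suc (Suc N)) $ (n - k))"
    by (simp add: fps_mult_nth)
  also have "\<dots> = (\<Sum>k=0..n. if k = n then (\<Prod>i\<le>N. C_factor (Suc i)) $ k else 0)"
    using step by (intro sum.cong) (auto simp: C_like_factor(2))
  also have "\<dots> = (\<Prod>i\<le>N. C_factor (Suc i)) $ n" by simp
  finally show ?case using step by simp
qed auto

lemma has_prod_limit:
  "(\<lambda>i. C_factor (Suc i)) has_prod Abs_fps (\<lambda>n. (\<Prod>i\<le>n. C_factor (Suc i)) $ n)"
proof -
  let ?F = "Abs_fps (\<lambda>n. (\<Prod>i\<le>n. C_factor (Suc i)) $ n)"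
  have "(\<lambda>N. \<Prod>i\<le>N. C_factor (Suc i)) \<longlonglongrightarrow> ?F"
  proof (rule tendsto_fpsI)
    fix n
    show "\<forall>\<^sub>F N in sequentially. (\<Prod>i\<le>N. C_factor (Suc i)) $ n = ?F $ n"
      unfolding fps_nth_Abs_fps using eventually_ge_at_top[of n]
      by eventually_elim (rule partial_prod_stable)
  qed
  moreover have "?F $ 0 = 1"
    using C_like_nth_0[OF C_like_prod[of 0]] by simp
  then have "?F \<noteq> 0" by (metis fps_zero_nth zero_neq_one)
  ultimately show ?thesis by (simp add: has_prod_def raw_has_prod_def)
qed

lemma prodinf_nth: "(\<Prod>i. C_factor (Suc i)) $ n = (\<Prod>i\<le>n. C_factor (Suc i)) $ n"
  unfolding has_prod_unique[OF has_prod_limit, symmetric] by simp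

lemma C_poly_eqI:
  assumes "to_fract p / qvar ^ n = (\<Prod>i. C_factor (Suc i)) $ n"
  shows "C_poly n = p"
  unfolding C_poly_def
proof (rule the_equality[where P = "\<lambda>p. to_fract p / qvar ^ n = (\<Prod>i. C_factor (Suc i)) $ n"])
  show "to_fract p / qvar ^ n = (\<Prod>i. C_factor (Suc i)) $ n" by fact
next
  fix p' assume "to_fract p' / qvar ^ n = (\<Prod>i. C_factor (Suc i)) $ n"
  with assms have "to_fract p' / qvar ^ n = to_fract p / qvar ^ n" by simp
  then show "p' = p" by simp
qed

lemma C_poly_nth:
  assumes "n \<ge> 1"
  shows "to_fract (C_poly n) / qvar ^ n = (\<Prod>i. C_factor (Suc i)) $ n"
    and "[:-1, 1:]\<^sup>2 dvd C_poly n"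
proof -
  obtain p where p: "(\<Prod>i. C_factor (Suc i)) $ n = to_fract ([:-1, 1:]\<^sup>2 * p) / qvar ^ n"
    using C_like_nth[OF C_like_prod assms] prodinf_nth by metis
  then have "C_poly n = [:-1, 1:]\<^sup>2 * p" by (intro C_poly_eqI) simp
  then show "to_fract (C_poly n) / qvar ^ n = (\<Prod>i. C_factor (Suc i)) $ n"
    and "[:-1, 1:]\<^sup>2 dvd C_poly n" using p by auto
qed

theorem C_poly_generating_function:
  "(\<lambda>i. C_factor (Suc i)) has_prod
     (1 + Abs_fps (\<lambda>n. if n \<ge> 1 then to_fract (C_poly n) / qvar ^ n else 0))"
proof -
  have "1 + Abs_fps (\<lambda>n. if n \<ge> 1 then to_fract (C_poly n) / qvar ^ n else 0) =
        Abs_fps (\<lambda>n. (\<Prod>i\<le>n. C_factor (Suc i)) $ n)"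
  proof (rule fps_ext)
    fix n
    show "(1 + Abs_fps (\<lambda>n. if n \<ge> 1 then to_fract (C_poly n) / qvar ^ n else 0)) $ n =
          Abs_fps (\<lambda>n. (\<Prod>i\<le>n. C_factor (Suc i)) $ n) $ n"
      using C_poly_nth(1)[of n] prodinf_nth[of n] C_like_nth_0[OF C_like_prod[of 0]]
      by (cases "n = 0") auto
  qed
  then show ?thesis using has_prod_limit by simp
qed

theorem P_poly_mult: "n \<ge> 1 \<Longrightarrow> P_poly n * [:-1, 1:]\<^sup>2 = C_poly n"
  unfolding P_poly_def by (rule dvd_div_mult_self[OF C_poly_nth(2)])

lemma lambda_1: "lambda 1 = 1"
  by (simp add: lambda_def)

lemma lambda_prime_power:
  assumes "prime p" "e \<ge> 1"
  shows "lambda (p ^ e) = lambda_pp p e"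
  using assms by (simp add: lambda_def prime_factorization_prime_power)

lemma lambda_mult:
  assumes "coprime m n"
  shows "lambda (m * n) = lambda m * lambda n"
proof (cases "m = 0 \<or> n = 0")
  case True
  then have "m = 0 \<and> n = 1 \<or> m = 1 \<and> n = 0" using assms by auto
  then show ?thesis by (elim disjE conjE) (simp_all add: lambda_def)
next
  case False
  have disj: "prime_factors m \<inter> prime_factors n = {}"
    using assms by (auto simp: in_prime_factors_iff dest: coprime_common_divisor_nat)
  have "lambda (m * n) = (\<Prod>p\<in>prime_factors m \<union> prime_factors n. lambda_pp p (multiplicity p (m * n)))"
    using False by (simp add: lambda_def prime_factors_product)
  also have "\<dots> = (\<Prod>p\<in>prime_factors m. lambda_pp p (multiplicity p (m * n))) *
                  (\<Prod>p\<in>prime_factors n. lambda_pp p (multiplicity p (m * n)))"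
    using disj by (intro prod.union_disjoint) auto
  also have "(\<Prod>p\<in>prime_factors m. lambda_pp p (multiplicity p (m * n))) = lambda m"
    unfolding lambda_def
  proof (intro prod.cong refl)
    fix p assume p: "p \<in> prime_factors m"
    then have "\<not> p dvd n" using disj False by (auto simp: in_prime_factors_iff)
    then show "lambda_pp p (multiplicity p (m * n)) = lambda_pp p (multiplicity p m)"
      using p False
      by (simp add: in_prime_factors_iff prime_elem_multiplicity_mult_distrib not_dvd_imp_multiplicity_0)
  qed
  also have "(\<Prod>p\<in>prime_factors n. lambda_pp p (multiplicity p (m * n))) = lambda n"
    unfolding lambda_def
  proof (intro prod.cong refl)
    fix p assume p: "p \<in> prime_factors n"
    then have "\<not> p dvd m" using disj False by (auto simp: in_prime_factors_iff)
    then show "lambda_pp p (multiplicity p (m * n)) = lambda_pp p (multiplicity p n)"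
      using p False
      by (simp add: in_prime_factors_iff prime_elem_multiplicity_mult_distrib not_dvd_imp_multiplicity_0)
  qed
  finally show ?thesis .
qed

end

theory Submission
  imports Defs
begin

text \<open>
  At a root of unity \<open>q\<close> the factor \<open>1 - (q + 1/q) t\<^sup>i + t\<^bsup>2i\<^esup>\<close> is a quotient or product of binomials \<open>1 \<plusminus> t\<^bsup>ki\<^esup>\<close>,
  so the generating function becomes a quotient of Euler products. The Jacobi triple product, obtained
  as the limit of its finite form with Gaussian binomials, turns the quotient into a product of two theta
  series \<open>\<theta>(z) = \<Sum> z\<^sup>n t\<^bsup>n^2\<^esup>\<close>: it is \<open>\<theta>(-1)(t) \<theta>(-1)(t)\<close> at \<open>q = -1\<close>,
  \<open>\<theta>(-1)(t) \<theta>(-1)(t\<^sup>2)\<close> at \<open>q = \<i>\<close> and \<open>\<theta>(-1)(t) \<theta>(-w)(t)\<close> at \<open>q = -w\<close>,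
  \<open>w\<close> a primitive cube root of unity. The coefficients are then sums over representations of \<open>n\<close> by a
  quadratic form, of terms determined by the residues of \<open>x\<close> and \<open>y\<close>.
  At \<open>q = w\<close> the quotient is \<open>\<eta>(\<tau>)\<^sup>3 / \<eta>(3\<tau>)\<close>, which is found by
  differentiating the triple product with respect to \<open>z\<close> at \<open>z = 1\<close> and at \<open>z = w\<close>; its coefficients are
  divisor sums of the quadratic character modulo 3.
\<close>

subsection \<open>The finite Jacobi triple product\<close>

text \<open>Hence the identities are first proved for finitely many factors and without
  denominators: Gaussian binomials are given by the Pascal recursion, and congruences modulo
  \<open>fps_X ^ N\<close> take the place of error estimates. In the cases that end in a product of
  two theta series the quadratic form is diagonal, x^2 + y^2 or x^2 + 2 y^2. The point w is
  different: eta(tau)^3 / eta(3 tau) belongs to x^2 + x y + y^2, which does not split into two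
  independent one-variable sums. Derivatives replace the second theta series: the triple product
  vanishes to first order at z = 1, so its derivative there is, up to sign, the cube of an Euler
  product, while at z = w its logarithmic derivative turns divisors into values of the character.
  The value -2 of \<open>lambda\<close> at powers of 3 is the ratio of the constants 6 and -3 that
  come out of this comparison.\<close>

fun qbinom :: "'a::comm_ring_1 \<Rightarrow> nat \<Rightarrow> nat \<Rightarrow> 'a" where
  "qbinom q n 0 = 1"
| "qbinom q 0 (Suc k) = 0"
| "qbinom q (Suc n) (Suc k) = qbinom q n k + q ^ Suc k * qbinom q n (Suc k)"

definition qfact :: "'a::comm_ring_1 \<Rightarrow> nat \<Rightarrow> 'a" where
  "qfact q n = (\<Prod>i<n. 1 - q ^ Suc i)"

lemma qfact_Suc: "qfact q (Suc n) = qfact q n * (1 - q ^ Suc n)"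
  by (simp add: qfact_def)

lemma qbinom_eq_0: "n < k \<Longrightarrow> qbinom q n k = 0"
  by (induction q n k rule: qbinom.induct) auto

lemma qbinom_same: "qbinom q n n = 1"
  by (induction n) (auto simp: qbinom_eq_0)

text \<open>The second q-Pascal rule. In the finite triple product the defining rule handles a new
  factor in y, this one a new factor in x.\<close>

lemma qbinom_Suc_Suc':
  "qbinom q (Suc n) (Suc k) = qbinom q n (Suc k) + q ^ (n - k) * qbinom q n k"
proof (induction n arbitrary: k)
  case 0
  then show ?case by (cases k) auto
next
  case (Suc n)
  show ?case
  proof (cases "k \<le> n")
    case False
    then show ?thesis
      by (cases "k = Suc n") (auto simp: qbinom_eq_0 qbinom_same simp del: qbinom.simps(3))
  next
    case True
    show ?thesis
    proof (cases k)
      case 0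
      have "qbinom q (Suc (Suc n)) (Suc 0) = 1 + q * qbinom q (Suc n) (Suc 0)"
        by (subst qbinom.simps(3)) simp
      also have "\<dots> = 1 + q * (qbinom q n (Suc 0) + q ^ n)"
        using Suc.IH[of 0] by simp
      also have "\<dots> = qbinom q (Suc n) (Suc 0) + q ^ Suc n"
        by (simp add: algebra_simps)
      finally show ?thesis using 0 by simp
    next
      case (Suc l)
      \<comment> \<open>Expanding by either rule first leaves a mixed term with the same total power
        q^(n+1), which is why the two groupings agree.\<close>
      have e: "Suc n - k = n - l" "n - k + Suc k = Suc n" "n - l + k = Suc n"
        using True Suc by auto
      have p: "q ^ Suc k * q ^ (n - k) = q ^ (n - l) * q ^ k"
        using e by (metis add.commute power_add)
      have "qbinom q (Suc (Suc n)) (Suc k) = qbinom q (Suc n) k + q ^ Suc k * qbinom q (Suc n) (Suc k)"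
        by simp
      also have "\<dots> = (qbinom q n k + q ^ (n - l) * qbinom q n l) + q ^ Suc k * (qbinom q n (Suc k) + q ^ (n - k) * qbinom q n k)"
        using Suc.IH[of k] Suc.IH[of l] unfolding Suc by (simp only:)
      also have "\<dots> = (qbinom q n k + q ^ Suc k * qbinom q n (Suc k)) + (q ^ (n - l) * qbinom q n l + (q ^ Suc k * q ^ (n - k)) * qbinom q n k)"
        by (simp only: algebra_simps)
      also have "\<dots> = (qbinom q n k + q ^ Suc k * qbinom q n (Suc k)) + q ^ (n - l) * (qbinom q n l + q ^ k * qbinom q n k)"
        unfolding p by (simp only: algebra_simps)
      also have "\<dots> = qbinom q (Suc n) (Suc k) + q ^ (Suc n - k) * qbinom q (Suc n) k"
        unfolding e(1) by (simp add: Suc)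
      finally show ?thesis .
    qed
  qed
qed

lemma qbinom_symmetric: "k \<le> n \<Longrightarrow> qbinom q n (n - k) = qbinom q n k"
proof (induction n arbitrary: k)
  case (Suc n)
  show ?case
  proof (cases "k = 0 \<or> k = Suc n")
    case True
    then show ?thesis using qbinom_same[of q "Suc n"] by auto
  next
    case False
    then obtain l where l: "k = Suc l" "l < n" using Suc.prems by (cases k) auto
    have e: "n - l = Suc (n - Suc l)" using l by auto
    have "qbinom q (Suc n) (Suc n - k) = qbinom q (Suc n) (Suc (n - k))"
      using l by (simp add: e)
    also have "\<dots> = qbinom q n (n - l) + q ^ (n - (n - k)) * qbinom q n (n - k)"
      using l e by (subst qbinom_Suc_Suc') simp
    also have "\<dots> = qbinom q n l + q ^ k * qbinom q n k"
      using l Suc.IH[of l] Suc.IH[of k] by simp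
    also have "\<dots> = qbinom q (Suc n) k" using l by simp
    finally show ?thesis .
  qed
qed auto

text \<open>The product formula for Gaussian binomials with its denominator cleared. After
  multiplying the recursion by \<open>qfact q (Suc l)\<close> the two terms combine, since q^(l+1)
  q^(n-l) = q^(n+1).\<close>

lemma qbinom_mult_qfact:
  "k \<le> n \<Longrightarrow> qbinom q n k * qfact q k = (\<Prod>i=n-k..<n. 1 - q ^ Suc i)"
proof (induction n arbitrary: k)
  case (Suc n)
  show ?case
  proof (cases k)
    case (Suc l)
    then have l: "l \<le> n" using Suc.prems by simp
    define P where "P = (\<Prod>i=n-l..<n. 1 - q ^ Suc i)"
    have P: "qbinom q n l * qfact q l = P" using Suc.IH[OF l] by (simp add: P_def)
    have "q ^ Suc l * (qbinom q n (Suc l) * qfact q (Suc l)) = q ^ Suc l * (1 - q ^ (n - l)) * P"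
    proof (cases "l = n")
      case True
      then show ?thesis by (simp add: qbinom_eq_0)
    next
      case False
      then have "Suc (n - Suc l) = n - l" using l by auto
      moreover have "(\<Prod>i=n-Suc l..<n. 1 - q ^ Suc i) = (1 - q ^ Suc (n - Suc l)) * (\<Prod>i=Suc (n-Suc l)..<n. 1 - q ^ Suc i)"
        using False l by (subst prod.atLeast_Suc_lessThan) auto
      ultimately show ?thesis using Suc.IH[of "Suc l"] False l by (simp add: P_def mult_ac)
    qed
    moreover have "q ^ Suc l * q ^ (n - l) = q ^ Suc n" unfolding power_add[symmetric] using l by simp
    moreover have "qbinom q (Suc n) (Suc l) * qfact q (Suc l) =
        P * (1 - q ^ Suc l) + q ^ Suc l * (qbinom q n (Suc l) * qfact q (Suc l))"
      unfolding P[symmetric] qbinom.simps(3) qfact_Suc[of q l] by (simp only: algebra_simps)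
    ultimately have "qbinom q (Suc n) (Suc l) * qfact q (Suc l) = P * (1 - q ^ Suc n)"
      by (simp only: left_diff_distrib right_diff_distrib mult_1_right mult_1_left mult_ac) (simp add: mult_ac)
    then show ?thesis using Suc l by (simp add: P_def Suc_diff_le)
  qed (auto simp: qfact_def)
qed (auto simp: qfact_def)

lemma power_dvd_prod_minus_1:
  assumes "a \<le> b"
  shows "(q::'a::comm_ring_1) ^ Suc a dvd (\<Prod>i=a..<b. 1 - q ^ Suc i) - 1"
  using assms
proof (induction b rule: dec_induct)
  case (step b)
  have "(\<Prod>i=a..<Suc b. 1 - q ^ Suc i) - 1 =
    ((\<Prod>i=a..<b. 1 - q ^ Suc i) - 1) - q ^ Suc b * (\<Prod>i=a..<b. 1 - q ^ Suc i)"
    unfolding prod.atLeastLessThan_Suc[OF step(1)] by (simp only: ring_distribs mult_1_right mult_1_left mult.commute diff_diff_eq2 diff_diff_eq add.commute)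
  moreover have "q ^ Suc a dvd q ^ Suc b" using step by (intro le_imp_power_dvd) simp
  ultimately show ?case using step.IH by (simp only: dvd_diff dvd_mult2)
qed auto

lemma dvd_mult_minus_1:
  fixes d :: "'a::comm_ring_1"
  assumes "d dvd a - 1" "d dvd b - 1"
  shows "d dvd a * b - 1"
proof -
  have "a * b - 1 = (a - 1) * b + (b - 1)" by (simp add: algebra_simps)
  then show ?thesis using assms by (simp only: dvd_add dvd_mult2)
qed

text \<open>Quantifies that central Gaussian binomials tend to 1 / (q;q). For k <= N the product
  consists of two blocks of factors 1 - q^(i+1), one with i >= 2N - k and one with i >= k, and each
  block is 1 modulo q^(k+1). Symmetry covers k > N.\<close>

lemma power_dvd_qbinom_mult_qfact_minus_1:
  assumes "k \<le> 2 * N"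
  shows "(q::'a::comm_ring_1) ^ Suc (min k (2 * N - k)) dvd qbinom q (2 * N) k * qfact q N - 1"
proof -
  have le: "q ^ Suc k dvd qbinom q (2 * N) k * qfact q N - 1" if "k \<le> N" for k
  proof -
    have "qfact q N = qfact q k * (\<Prod>i=k..<N. 1 - q ^ Suc i)"
      unfolding qfact_def lessThan_atLeast0 by (rule prod.atLeastLessThan_concat[symmetric]) (use that in auto)
    then have "qbinom q (2 * N) k * qfact q N = (\<Prod>i=2*N-k..<2*N. 1 - q ^ Suc i) * (\<Prod>i=k..<N. 1 - q ^ Suc i)"
      using qbinom_mult_qfact[of k "2*N" q] that by (simp add: mult.assoc[symmetric])
    moreover have "q ^ Suc k dvd (\<Prod>i=2*N-k..<2*N. 1 - q ^ Suc i) - 1"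
      by (rule dvd_trans[OF le_imp_power_dvd power_dvd_prod_minus_1]) (use that in auto)
    moreover have "q ^ Suc k dvd (\<Prod>i=k..<N. 1 - q ^ Suc i) - 1"
      using that by (rule power_dvd_prod_minus_1)
    ultimately show ?thesis using dvd_mult_minus_1 by metis
  qed
  show ?thesis
  proof (cases "k \<le> N")
    case True
    then show ?thesis using le[of k] by (simp add: min_def)
  next
    case False
    then have "2 * N - k \<le> N" "min k (2 * N - k) = 2 * N - k" by auto
    then show ?thesis using le[of "2 * N - k"] qbinom_symmetric[OF assms, of q] by simp
  qed
qed

text \<open>
  With \<open>x * y = q\<close> this is the general term \<open>x\<^sup>n q\<^bsup>n(n-1)/2\<^esup>\<close> of the bilateral theta series,
  written so that no negative exponent occurs.
\<close>

definition jtp_coeff :: "'a::comm_ring_1 \<Rightarrow> 'a \<Rightarrow> int \<Rightarrow> 'a" where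
  "jtp_coeff x y n = x ^ nat (n * (n + 1) div 2) * y ^ nat (n * (n - 1) div 2)"

text \<open>Expresses all exponents at n and n - 1 linearly in one integer a, with the signs needed
  to remove \<open>nat\<close>; afterwards exponent identities are linear arithmetic.\<close>

lemma triangular_step:
  fixes n :: int
  obtains a where "n * (n + 1) div 2 = a + n" "n * (n - 1) div 2 = a" "a \<ge> 0" "a + n \<ge> 0"
    "(n - 1) * (n - 1 - 1) div 2 = a - n + 1" "(n - 1) * (n - 1 + 1) div 2 = a" "a - n + 1 \<ge> 0"
proof -
  define a where "a = n * (n - 1) div 2"
  have a: "n * (n - 1) = 2 * a" by (simp add: a_def)
  have pos: "m * (m - 1) \<ge> 0" for m :: int
    by (cases "m \<ge> 1") (auto simp: mult_nonneg_nonneg mult_nonpos_nonpos)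
  have *: "n * (n + 1) = 2 * (a + n)" "(n - 1) * (n - 1 - 1) = 2 * (a - n + 1)" "(n - 1) * (n - 1 + 1) = 2 * a"
    using a by (auto simp: algebra_simps)
  have "2 * a \<ge> 0" "2 * (a + n) \<ge> 0" "2 * (a - n + 1) \<ge> 0"
    using pos[of n] pos[of "n + 1"] pos[of "n - 1"] unfolding a[symmetric] *[symmetric]
    by (simp_all add: mult.commute)
  then show ?thesis by (intro that[of a]) (simp_all only: * a, simp_all)
qed

text \<open>The ratio of consecutive terms is x q^k. Both sides carry extra powers of q so that no
  exponent is negative.\<close>

lemma jtp_coeff_step_x:
  assumes "x * y = q" "k \<le> M"
  shows "jtp_coeff x y (int k) * x * q ^ M = jtp_coeff x y (int k + 1) * q ^ (M - k)"
proof -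
  define n where "n = int k + 1"
  obtain a where a: "n * (n + 1) div 2 = a + n" "n * (n - 1) div 2 = a" "a \<ge> 0" "a + n \<ge> 0"
    "(n - 1) * (n - 1 - 1) div 2 = a - n + 1" "(n - 1) * (n - 1 + 1) div 2 = a" "a - n + 1 \<ge> 0"
    by (rule triangular_step)
  have "nat a + 1 + M = nat (a + n) + (M - k)" "nat (a - n + 1) + M = nat a + (M - k)"
    using a assms(2) by (auto simp: n_def)
  then have p: "x ^ nat a * x * x ^ M = x ^ nat (a + n) * x ^ (M - k)"
     "y ^ nat (a - n + 1) * y ^ M = y ^ nat a * y ^ (M - k)"
    by (metis power_add power_one_right)+
  have "jtp_coeff x y (n - 1) * x * q ^ M = (x ^ nat a * x * x ^ M) * (y ^ nat (a - n + 1) * y ^ M)"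
    using a(5,6) by (simp add: jtp_coeff_def assms(1)[symmetric] power_mult_distrib mult_ac)
  also have "\<dots> = jtp_coeff x y n * q ^ (M - k)"
    unfolding p using a(1,2) by (simp add: jtp_coeff_def assms(1)[symmetric] power_mult_distrib mult_ac)
  finally show ?thesis by (simp add: n_def add.commute)
qed

text \<open>The same ratio of neighbours, read downwards at n = k - N, which may be negative; the
  padding by q^N keeps the exponents natural.\<close>

lemma jtp_coeff_step_y:
  assumes "x * y = q"
  shows "jtp_coeff x y (int k - int N - 1) * q ^ k = jtp_coeff x y (int k - int N) * y * q ^ N"
proof -
  define n where "n = int k - int N"
  obtain a where a: "n * (n + 1) div 2 = a + n" "n * (n - 1) div 2 = a" "a \<ge> 0" "a + n \<ge> 0"
    "(n - 1) * (n - 1 - 1) div 2 = a - n + 1" "(n - 1) * (n - 1 + 1) div 2 = a" "a - n + 1 \<ge> 0"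
    by (rule triangular_step)
  have "nat a + k = nat (a + n) + N" "nat (a - n + 1) + k = nat a + 1 + N"
    using a by (auto simp: n_def)
  then have p: "x ^ nat a * x ^ k = x ^ nat (a + n) * x ^ N"
     "y ^ nat (a - n + 1) * y ^ k = y ^ nat a * y * y ^ N"
    by (metis power_add power_one_right)+
  have "jtp_coeff x y (n - 1) * q ^ k = (x ^ nat a * x ^ k) * (y ^ nat (a - n + 1) * y ^ k)"
    using a(5,6) by (simp add: jtp_coeff_def assms(1)[symmetric] power_mult_distrib mult_ac)
  also have "\<dots> = jtp_coeff x y n * y * q ^ N"
    unfolding p using a(1,2) by (simp add: jtp_coeff_def assms(1)[symmetric] power_mult_distrib mult_ac)
  finally show ?thesis unfolding n_def .
qed

text \<open>For N = 0 this is the q-binomial theorem. Separate lengths M and N allow one factor to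
  be added at a time, each side with its own Pascal rule.\<close>

lemma finite_jacobi_triple:
  fixes x y q :: "'a::comm_ring_1"
  assumes q: "x * y = q"
  shows "(\<Prod>i<M. 1 + x * q ^ i) * (\<Prod>i<N. 1 + y * q ^ i) =
         (\<Sum>k\<le>M + N. jtp_coeff x y (int k - int N) * qbinom q (M + N) k)"
proof (induction N)
  case 0
  show ?case
  proof (induction M)
    case 0
    then show ?case by (simp add: jtp_coeff_def)
  next
    case (Suc M)
    define c where "c k = jtp_coeff x y (int k)" for k
    have step: "c (Suc k) * q ^ (M - k) = c k * x * q ^ M" if "k \<le> M" for k
      using jtp_coeff_step_x[OF q that] by (simp add: c_def add.commute)
    have "(\<Sum>k\<le>Suc M. c k * qbinom q (Suc M) k) =
       c 0 * qbinom q M 0 + (\<Sum>k\<le>M. c (Suc k) * qbinom q (Suc M) (Suc k))"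
      by (subst sum.atMost_Suc_shift) (simp only: qbinom.simps(1))
    also have "(\<Sum>k\<le>M. c (Suc k) * qbinom q (Suc M) (Suc k)) =
       (\<Sum>k\<le>M. c (Suc k) * qbinom q M (Suc k)) + (\<Sum>k\<le>M. (c (Suc k) * q ^ (M - k)) * qbinom q M k)"
      unfolding qbinom_Suc_Suc' ring_distribs sum.distrib by (simp only: mult.assoc)
    also have "(\<Sum>k\<le>M. (c (Suc k) * q ^ (M - k)) * qbinom q M k) = x * q ^ M * (\<Sum>k\<le>M. c k * qbinom q M k)"
      unfolding sum_distrib_left by (intro sum.cong refl) (simp add: step mult_ac)
    also have "c 0 * qbinom q M 0 + ((\<Sum>k\<le>M. c (Suc k) * qbinom q M (Suc k)) + x * q ^ M * (\<Sum>k\<le>M. c k * qbinom q M k)) =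
       (\<Sum>k\<le>Suc M. c k * qbinom q M k) + x * q ^ M * (\<Sum>k\<le>M. c k * qbinom q M k)"
      unfolding sum.atMost_Suc_shift add.assoc ..
    also have "(\<Sum>k\<le>Suc M. c k * qbinom q M k) = (\<Sum>k\<le>M. c k * qbinom q M k)"
      by (simp add: qbinom_eq_0)
    finally have "(\<Sum>k\<le>Suc M. c k * qbinom q (Suc M) k) = (\<Sum>k\<le>M. c k * qbinom q M k) * (1 + x * q ^ M)"
      unfolding distrib_left mult_1_right by (simp only: mult.commute)
    then show ?case using Suc by (simp add: c_def mult_ac)
  qed
next
  case (Suc N)
  define L where "L = M + N"
  define c where "c k = jtp_coeff x y (int k - int N)" for k
  define d where "d k = jtp_coeff x y (int k - int N - 1)" for k
  have dc: "d (Suc k) = c k" for k by (simp add: d_def c_def)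
  have step: "d k * q ^ k = c k * y * q ^ N" for k
    using jtp_coeff_step_y[OF q] by (simp add: d_def c_def)
  have "(\<Sum>k\<le>Suc L. d k * qbinom q (Suc L) k) =
     d 0 * q ^ 0 * qbinom q L 0 + (\<Sum>k\<le>L. d (Suc k) * qbinom q (Suc L) (Suc k))"
    by (subst sum.atMost_Suc_shift) (simp only: qbinom.simps(1) power_0 mult_1_right)
  also have "(\<Sum>k\<le>L. d (Suc k) * qbinom q (Suc L) (Suc k)) =
     (\<Sum>k\<le>L. c k * qbinom q L k) + (\<Sum>k\<le>L. d (Suc k) * q ^ Suc k * qbinom q L (Suc k))"
    unfolding qbinom.simps(3) ring_distribs sum.distrib dc by (simp only: mult.assoc)
  also have "d 0 * q ^ 0 * qbinom q L 0 + \<dots> = (\<Sum>k\<le>L. c k * qbinom q L k) + (\<Sum>k\<le>Suc L. d k * q ^ k * qbinom q L k)"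
    unfolding sum.atMost_Suc_shift by (simp only: add_ac)
  also have "(\<Sum>k\<le>Suc L. d k * q ^ k * qbinom q L k) = (\<Sum>k\<le>L. d k * q ^ k * qbinom q L k)"
    by (simp add: qbinom_eq_0)
  also have "(\<Sum>k\<le>L. d k * q ^ k * qbinom q L k) = y * q ^ N * (\<Sum>k\<le>L. c k * qbinom q L k)"
    unfolding step sum_distrib_left by (simp only: mult_ac)
  finally have "(\<Sum>k\<le>Suc L. d k * qbinom q (Suc L) k) = (\<Sum>k\<le>L. c k * qbinom q L k) * (1 + y * q ^ N)"
    unfolding distrib_left mult_1_right by (simp only: mult.commute)
  moreover have "d k = jtp_coeff x y (int k - int (Suc N))" for k
    unfolding d_def by (rule arg_cong) simp
  moreover have "(\<Prod>i<M. 1 + x * q ^ i) * (\<Prod>i<N. 1 + y * q ^ i) = (\<Sum>k\<le>L. c k * qbinom q L k)"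
    using Suc by (simp only: c_def L_def)
  ultimately show ?case by (simp only: L_def prod.lessThan_Suc add_Suc_right mult.assoc[symmetric])
qed

text \<open>Term by term the error is \<open>jtp_coeff\<close> times a multiple of q^(N - |n| + 1).
  When |n| is close to N that power is small, and the theta term itself must supply the rest of
  \<open>d\<close>.\<close>

lemma jacobi_triple_dvd:
  fixes x y q d :: "'a::comm_ring_1"
  assumes q: "x * y = q"
    and d: "\<And>n. \<bar>n\<bar> \<le> int N \<Longrightarrow> d dvd jtp_coeff x y n * q ^ Suc (N - nat \<bar>n\<bar>)"
  shows "d dvd qfact q N * (\<Prod>i<N. 1 + x * q ^ i) * (\<Prod>i<N. 1 + y * q ^ i) - (\<Sum>n=-int N..int N. jtp_coeff x y n)"
proof -
  have "(\<Sum>n=-int N..int N. jtp_coeff x y n) = (\<Sum>k\<le>2*N. jtp_coeff x y (int k - int N))"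
    by (rule sum.reindex_bij_witness[of _ "\<lambda>k. int k - int N" "\<lambda>n. nat (n + int N)"]) auto
  then have "qfact q N * (\<Prod>i<N. 1 + x * q ^ i) * (\<Prod>i<N. 1 + y * q ^ i) - (\<Sum>n=-int N..int N. jtp_coeff x y n) =
    (\<Sum>k\<le>2*N. jtp_coeff x y (int k - int N) * (qbinom q (2 * N) k * qfact q N - 1))"
    unfolding mult.assoc finite_jacobi_triple[OF q] mult_2[symmetric]
    by (simp add: sum_distrib_left algebra_simps sum_subtractf)
  also have "d dvd \<dots>"
  proof (rule dvd_sum)
    fix k assume k: "k \<in> {..2 * N}"
    have *: "N - nat \<bar>int k - int N\<bar> = min k (2 * N - k)" using k by auto
    have "d dvd jtp_coeff x y (int k - int N) * q ^ Suc (min k (2 * N - k))"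
      using d[of "int k - int N"] k unfolding * by auto
    also have "\<dots> dvd jtp_coeff x y (int k - int N) * (qbinom q (2 * N) k * qfact q N - 1)"
      using k by (intro mult_dvd_mono power_dvd_qbinom_mult_qfact_minus_1) auto
    finally show "d dvd jtp_coeff x y (int k - int N) * (qbinom q (2 * N) k * qfact q N - 1)" .
  qed
  finally show ?thesis .
qed

subsection \<open>Euler products and theta series\<close>

lemma tendsto_mult_fps:
  fixes f g :: "'b \<Rightarrow> 'a::comm_ring_1 fps"
  assumes "(f \<longlongrightarrow> a) F" "(g \<longlongrightarrow> b) F"
  shows "((\<lambda>x. f x * g x) \<longlongrightarrow> a * b) F"
proof (rule tendsto_fpsI)
  fix n
  have "\<forall>\<^sub>F x in F. \<forall>i\<in>{..n}. f x $ i = a $ i" "\<forall>\<^sub>F x in F. \<forall>i\<in>{..n}. g x $ i = b $ i"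
    using assms by (simp_all add: tendsto_fps_iff eventually_ball_finite_distrib del: atMost_iff)
  then show "\<forall>\<^sub>F x in F. (f x * g x) $ n = (a * b) $ n"
    by eventually_elim (simp add: fps_mult_nth)
qed

lemma tendsto_fps_dvd:
  fixes f g :: "nat \<Rightarrow> 'a::comm_ring_1 fps"
  assumes "g \<longlonglongrightarrow> a" "\<And>N. fps_X ^ N dvd f N - g N"
  shows "f \<longlonglongrightarrow> a"
proof (rule tendsto_fpsI)
  fix n
  have "\<forall>\<^sub>F N in sequentially. g N $ n = a $ n" using assms(1) by (simp add: tendsto_fps_iff)
  then show "\<forall>\<^sub>F N in sequentially. f N $ n = a $ n"
    using eventually_gt_at_top[of n]
  proof eventually_elim
    case (elim N)
    obtain h where "f N - g N = fps_X ^ N * h" using assms(2)[of N] by (auto simp: dvd_def)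
    then have "(f N - g N) $ n = 0" using elim by (simp add: fps_X_power_mult_nth)
    then show ?case using elim by simp
  qed
qed

text \<open>
  Slightly more than \<open>t\<close>-adic convergence: the \<open>i\<close>-th factor is \<open>1 + O(t\<^bsup>i+1\<^esup>)\<close>, so
  that the \<open>n\<close>-th coefficient of the product depends on the first \<open>n\<close> factors only.
\<close>

definition fps_prod_converges :: "(nat \<Rightarrow> 'a::comm_ring_1 fps) \<Rightarrow> bool" where
  "fps_prod_converges f \<longleftrightarrow> (\<forall>i. \<forall>k\<le>i. f i $ k = (if k = 0 then 1 else 0))"

definition fps_prodinf :: "(nat \<Rightarrow> 'a::comm_ring_1 fps) \<Rightarrow> 'a fps" where
  "fps_prodinf f = Abs_fps (\<lambda>n. (\<Prod>i<n. f i) $ n)"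

lemma fps_prod_stable:
  assumes "fps_prod_converges f" "n \<le> N"
  shows "(\<Prod>i<N. f i) $ n = (\<Prod>i<n. f i) $ n"
  using assms(2)
proof (induction N rule: dec_induct)
  case base
  show ?case by (rule refl)
next
  case (step N)
  have "((\<Prod>i<N. f i) * f N) $ n = (\<Sum>k=0..n. (\<Prod>i<N. f i) $ k * f N $ (n - k))"
    by (simp add: fps_mult_nth)
  also have "\<dots> = (\<Sum>k=0..n. if k = n then (\<Prod>i<N. f i) $ k else 0)"
    using step assms(1) by (intro sum.cong) (auto simp: fps_prod_converges_def)
  also have "\<dots> = (\<Prod>i<N. f i) $ n" by simp
  finally show ?case using step by simp
qed

lemma tendsto_fps_prodinf:
  assumes "fps_prod_converges f"
  shows "(\<lambda>N. \<Prod>i<N. f i) \<longlonglongrightarrow> fps_prodinf f"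
proof (rule tendsto_fpsI)
  fix n show "\<forall>\<^sub>F N in sequentially. (\<Prod>i<N. f i) $ n = fps_prodinf f $ n"
    unfolding fps_prodinf_def fps_nth_Abs_fps using eventually_ge_at_top[of n]
    by eventually_elim (rule fps_prod_stable[OF assms])
qed

lemma fps_prodinf_mult:
  assumes "fps_prod_converges f" "fps_prod_converges g" "fps_prod_converges h" "\<And>i. f i * g i = h i"
  shows "fps_prodinf f * fps_prodinf g = fps_prodinf h"
proof -
  have "(\<lambda>N. (\<Prod>i<N. f i) * (\<Prod>i<N. g i)) \<longlonglongrightarrow> fps_prodinf f * fps_prodinf g"
    by (intro tendsto_mult_fps tendsto_fps_prodinf assms)
  moreover have "(\<lambda>N. (\<Prod>i<N. f i) * (\<Prod>i<N. g i)) = (\<lambda>N. \<Prod>i<N. h i)"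
    by (simp add: assms(4) flip: prod.distrib)
  ultimately show ?thesis
    using tendsto_fps_prodinf[OF assms(3)] LIMSEQ_unique by metis
qed

lemma fps_prodinf_nth_0: "fps_prodinf f $ 0 = 1"
  by (simp add: fps_prodinf_def)

lemma fps_prodinf_nonzero: "fps_prodinf f \<noteq> 0"
  using fps_prodinf_nth_0[of f] by (metis fps_zero_nth zero_neq_one)

text \<open>With t = exp(2 pi i tau), \<open>eulerE m\<close> is eta(m tau) without its fractional
  power of t. \<open>eulerF\<close> and \<open>eulerO\<close> stand for the quotients E(2m)/E(m) and
  E(m)/E(2m), so that divisions can be written as products.\<close>

definition eulerE :: "nat \<Rightarrow> complex fps" where
  "eulerE m = fps_prodinf (\<lambda>i. 1 - fps_X ^ (m * Suc i))"

definition eulerF :: "nat \<Rightarrow> complex fps" where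
  "eulerF m = fps_prodinf (\<lambda>i. 1 + fps_X ^ (m * Suc i))"

definition eulerO :: "nat \<Rightarrow> complex fps" where
  "eulerO m = fps_prodinf (\<lambda>i. 1 - fps_X ^ (m * (2 * i + 1)))"

lemma less_mult_Suc: "m > 0 \<Longrightarrow> i < m * Suc i" "m > 0 \<Longrightarrow> i < m * (2 * i + 1)"
  using mult_le_mono1[of 1 m "Suc i"] mult_le_mono1[of 1 m "2 * i + 1"] by auto

lemma euler_converges:
  assumes "m > 0"
  shows "fps_prod_converges (\<lambda>i. 1 - fps_X ^ (m * Suc i) :: complex fps)"
    "fps_prod_converges (\<lambda>i. 1 + fps_X ^ (m * Suc i) :: complex fps)"
    "fps_prod_converges (\<lambda>i. 1 - fps_X ^ (m * (2 * i + 1)) :: complex fps)"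
  proof -
  have *: "k \<noteq> m * Suc i" "k \<noteq> m * (2 * i + 1)" if "k \<le> i" for k i
    using less_mult_Suc[OF assms, of i] that by linarith+
  show "fps_prod_converges (\<lambda>i. 1 - fps_X ^ (m * Suc i) :: complex fps)"
    "fps_prod_converges (\<lambda>i. 1 + fps_X ^ (m * Suc i) :: complex fps)"
    "fps_prod_converges (\<lambda>i. 1 - fps_X ^ (m * (2 * i + 1)) :: complex fps)"
    unfolding fps_prod_converges_def fps_sub_nth fps_add_nth fps_one_nth fps_X_power_nth
    using * by auto
qed

lemma eulerE_mult_eulerF: "m > 0 \<Longrightarrow> eulerE m * eulerF m = eulerE (2 * m)"
  unfolding eulerE_def eulerF_def
proof (rule fps_prodinf_mult)
  have "(1 - u) * (1 + u) = 1 - u ^ 2" for u :: "complex fps"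
    by (simp add: algebra_simps power2_eq_square)
  then show "(1 - fps_X ^ (m * Suc i)) * (1 + fps_X ^ (m * Suc i)) = (1 - fps_X ^ (2 * m * Suc i) :: complex fps)" for i
    by (simp only: power_mult[symmetric] mult_ac)
qed (rule euler_converges; simp)+

text \<open>The exponents of E(m) are split by parity. N odd and N even factors make up 2N factors
  of E(m), so the limit is taken along a subsequence of its partial products.\<close>

lemma eulerO_mult_eulerE:
  assumes "m > 0"
  shows "eulerO m * eulerE (2 * m) = eulerE m"
proof -
  let ?o = "\<lambda>i. 1 - fps_X ^ (m * (2 * i + 1)) :: complex fps"
  let ?e = "\<lambda>m i. 1 - fps_X ^ (m * Suc i) :: complex fps"
  have "(\<Prod>i<N. ?o i) * (\<Prod>i<N. ?e (2 * m) i) = (\<Prod>i<2*N. ?e m i)" for N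
    by (induction N) (auto simp: algebra_simps)
  moreover have "(\<lambda>N. (\<Prod>i<N. ?o i) * (\<Prod>i<N. ?e (2 * m) i)) \<longlonglongrightarrow> eulerO m * eulerE (2 * m)"
    unfolding eulerE_def eulerO_def
    by (intro tendsto_mult_fps tendsto_fps_prodinf euler_converges) (use assms in auto)
  moreover have "(\<lambda>N. \<Prod>i<2*N. ?e m i) \<longlonglongrightarrow> eulerE m"
    unfolding eulerE_def
    by (rule filterlim_compose[OF tendsto_fps_prodinf[OF euler_converges(1)[OF assms]]])
       (rule mult_nat_left_at_top, simp)
  ultimately show ?thesis using LIMSEQ_unique by fastforce
qed

lemma euler_nonzero: "eulerE m \<noteq> 0" "eulerF m \<noteq> 0" "eulerO m \<noteq> 0"
  by (simp_all add: eulerE_def eulerF_def eulerO_def fps_prodinf_nonzero)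

text \<open>Euler's identity behind the equality of partitions into odd parts and into distinct
  parts.\<close>

lemma eulerO_mult_eulerF:
  assumes "m > 0"
  shows "eulerO m * eulerF m = 1"
proof -
  have "eulerE m * (eulerO m * eulerF m) = eulerE m * 1"
    using eulerE_mult_eulerF[OF assms] eulerO_mult_eulerE[OF assms] by (metis mult.assoc mult.commute mult_1_right)
  then show ?thesis using euler_nonzero by (metis mult_left_cancel)
qed

section \<open>Theta series as values of the triple product\<close>

definition theta :: "nat \<Rightarrow> complex \<Rightarrow> complex fps" where
  "theta m z = Abs_fps (\<lambda>k. \<Sum>n | int m * n\<^sup>2 = int k. z powi n)"

lemma abs_le_square_int: "\<bar>n\<bar> \<le> (n::int)\<^sup>2"
proof -
  have "\<bar>n\<bar> * 1 \<le> \<bar>n\<bar> * \<bar>n\<bar>" by (cases "n = 0") (auto intro!: mult_left_mono simp del: abs_mult_self_eq)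
  then show ?thesis by (simp add: power2_eq_square flip: abs_mult)
qed

lemma square_root_bound: "m > 0 \<Longrightarrow> int m * n\<^sup>2 = int k \<Longrightarrow> \<bar>n\<bar> \<le> int k"
  using abs_le_square_int[of n] mult_right_mono[of 1 "int m" "n\<^sup>2"] by auto

lemma finite_square_roots:
  assumes "m > 0"
  shows "finite {n. int m * n\<^sup>2 = int k}"
proof (rule finite_subset)
  show "{n. int m * n\<^sup>2 = int k} \<subseteq> {-int k..int k}"
    using square_root_bound[OF assms] by fastforce
qed simp

text \<open>The choice x = z t^m, y = t^m / z, q = t^(2m) turns the general term into z^n t^(m n^2),
  because n(n+1)/2 + n(n-1)/2 = n^2.\<close>

lemma jacobi_triple_theta:
  assumes "m > 0" "z \<noteq> 0"
  shows "(\<lambda>N. (\<Prod>i<N. 1 - fps_X ^ (2 * m * Suc i)) *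
     (\<Prod>i<N. (1 + fps_const z * fps_X ^ (m * (2 * i + 1))) * (1 + fps_const (inverse z) * fps_X ^ (m * (2 * i + 1)))))
     \<longlonglongrightarrow> theta m z"
proof -
  define x where "x = fps_const z * fps_X ^ m"
  define y where "y = fps_const (inverse z) * fps_X ^ m"
  define q :: "complex fps" where "q = fps_X ^ (2 * m)"
  have q: "x * y = q"
  proof -
    have "x * y = fps_const (z * inverse z) * (fps_X ^ m * fps_X ^ m)"
      unfolding x_def y_def fps_const_mult[symmetric] by (simp only: mult_ac)
    then show ?thesis using assms(2) by (simp add: q_def mult_2 power_add)
  qed
  have c: "jtp_coeff x y n = fps_const (z powi n) * fps_X ^ nat (int m * n\<^sup>2)" for n
  proof -
    obtain a where a: "n * (n + 1) div 2 = a + n" "n * (n - 1) div 2 = a" "a \<ge> 0" "a + n \<ge> 0"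
      by (rule triangular_step)
    have "even (n * (n - 1))" by simp
    then have "n * (n - 1) = 2 * a" using a(2) by (metis dvd_mult_div_cancel)
    then have n: "n\<^sup>2 = 2 * a + n" by (simp add: power2_eq_square algebra_simps)
    have "z powi n = z powi (a + n) * z powi (- a)"
      using assms(2) by (simp flip: power_int_add)
    also have "\<dots> = z ^ nat (a + n) * inverse z ^ nat a"
      using a by (simp add: power_int_def power_inverse)
    finally have z: "z powi n = z ^ nat (a + n) * inverse z ^ nat a" .
    have "nat (int m * n\<^sup>2) = m * nat (2 * a + n)"
      unfolding n using a by (simp add: nat_mult_distrib)
    also have "nat (2 * a + n) = nat (a + n) + nat a"
      using a by linarith
    finally have "nat (int m * n\<^sup>2) = m * nat (a + n) + m * nat a"
      by (simp add: distrib_left)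
    then show ?thesis unfolding jtp_coeff_def a(1,2) z x_def y_def
      by (simp add: power_mult_distrib power_add power_mult mult_ac flip: fps_const_power fps_const_mult)
  qed
  have "(\<lambda>N. \<Sum>n=-int N..int N. jtp_coeff x y n) \<longlonglongrightarrow> theta m z"
  proof (rule tendsto_fpsI)
    fix k
    show "\<forall>\<^sub>F N in sequentially. (\<Sum>n=-int N..int N. jtp_coeff x y n) $ k = theta m z $ k"
      using eventually_ge_at_top[of k]
    proof eventually_elim
      case (elim N)
      have "(\<Sum>n=-int N..int N. jtp_coeff x y n) $ k = (\<Sum>n=-int N..int N. if int m * n\<^sup>2 = int k then z powi n else 0)"
        unfolding c fps_sum_nth by (intro sum.cong) (auto simp: fps_X_power_nth)
      also have "\<dots> = (\<Sum>n\<in>{n\<in>{-int N..int N}. int m * n\<^sup>2 = int k}. z powi n)"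
        by (rule sum.inter_filter[symmetric]) simp
      also have "{n\<in>{-int N..int N}. int m * n\<^sup>2 = int k} = {n. int m * n\<^sup>2 = int k}"
        using square_root_bound[OF assms(1)] elim by fastforce
      finally show ?case by (simp add: theta_def)
    qed
  qed
  then have "(\<lambda>N. qfact q N * (\<Prod>i<N. 1 + x * q ^ i) * (\<Prod>i<N. 1 + y * q ^ i)) \<longlonglongrightarrow> theta m z"
  proof (rule tendsto_fps_dvd)
    fix N
    show "fps_X ^ N dvd qfact q N * (\<Prod>i<N. 1 + x * q ^ i) * (\<Prod>i<N. 1 + y * q ^ i) - (\<Sum>n=-int N..int N. jtp_coeff x y n)"
    proof (rule jacobi_triple_dvd[OF q])
      fix n assume n: "\<bar>n\<bar> \<le> int N"
      \<comment> \<open>Written out, this square gives n^2 + 2(N - |n| + 1) >= 2N + 1, more than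
        enough for divisibility by t^N.\<close>
      have "(\<bar>n\<bar> - 1)\<^sup>2 \<ge> 0" by simp
      then have "n\<^sup>2 + 2 * int (Suc (N - nat \<bar>n\<bar>)) \<ge> int N"
        using n by (simp add: power2_diff of_nat_diff)
      then have *: "1 * int N \<le> int m * (n\<^sup>2 + 2 * int (Suc (N - nat \<bar>n\<bar>)))"
        using assms(1) by (intro mult_mono) auto
      have "N \<le> nat (int m * n\<^sup>2) + 2 * m * Suc (N - nat \<bar>n\<bar>)"
      proof -
        have "int m * n\<^sup>2 = int (nat (int m * n\<^sup>2))" by simp
        moreover have "int m * (n\<^sup>2 + 2 * int (Suc (N - nat \<bar>n\<bar>))) = int m * n\<^sup>2 + int (2 * m * Suc (N - nat \<bar>n\<bar>))"
          unfolding distrib_left of_nat_mult by (simp only: mult.left_commute mult.assoc of_nat_numeral)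
        ultimately show ?thesis using * by linarith
      qed
      then have "fps_X ^ N dvd (fps_X ^ (nat (int m * n\<^sup>2) + 2 * m * Suc (N - nat \<bar>n\<bar>)) :: complex fps)"
        by (rule le_imp_power_dvd)
      moreover have "jtp_coeff x y n * q ^ Suc (N - nat \<bar>n\<bar>) = fps_const (z powi n) * fps_X ^ (nat (int m * n\<^sup>2) + 2 * m * Suc (N - nat \<bar>n\<bar>))"
        unfolding c q_def by (simp only: power_add power_mult mult.assoc)
      ultimately show "fps_X ^ N dvd jtp_coeff x y n * q ^ Suc (N - nat \<bar>n\<bar>)"
        by simp
    qed
  qed
  moreover have "x * q ^ i = fps_const z * fps_X ^ (m * (2 * i + 1))" "y * q ^ i = fps_const (inverse z) * fps_X ^ (m * (2 * i + 1))"
     for i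
    by (simp_all add: x_def y_def q_def algebra_simps power_add flip: power_mult)
  moreover have "q ^ Suc i = fps_X ^ (2 * m * Suc i)" for i
    unfolding q_def by (simp only: power_mult)
  ultimately show ?thesis unfolding qfact_def by (simp only: prod.distrib mult.assoc)
qed

lemma theta_minus_1:
  assumes "m > 0"
  shows "theta m (-1) = eulerE (2 * m) * eulerO m ^ 2"
proof (rule LIMSEQ_unique[OF jacobi_triple_theta[OF assms]])
  have "(\<lambda>N. (\<Prod>i<N. 1 - fps_X ^ (2 * m * Suc i)) * ((\<Prod>i<N. 1 - fps_X ^ (m * (2 * i + 1))) * (\<Prod>i<N. 1 - fps_X ^ (m * (2 * i + 1)))))
    \<longlonglongrightarrow> eulerE (2 * m) * (eulerO m * eulerO m)"
    unfolding eulerE_def eulerO_def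
    by (intro tendsto_mult_fps tendsto_fps_prodinf euler_converges) (use assms in auto)
  moreover have "fps_const (-1::complex) = -1" "inverse (-1::complex) = -1"
    by (simp_all add: fps_eq_iff)
  ultimately show "(\<lambda>N. (\<Prod>i<N. 1 - fps_X ^ (2 * m * Suc i)) *
         (\<Prod>i<N. (1 + fps_const (- 1) * fps_X ^ (m * (2 * i + 1))) *
                  (1 + fps_const (inverse (- 1)) * fps_X ^ (m * (2 * i + 1)))))
    \<longlonglongrightarrow> eulerE (2 * m) * (eulerO m)\<^sup>2"
    by (simp only: prod.distrib power2_eq_square mult_minus_left mult_1_left diff_conv_add_uminus)
qed simp

text \<open>Gauss's product E(m)^2 / E(2m) for the alternating theta series, with E(2m)/E(m)
  replaced by \<open>eulerF m\<close>.\<close>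

lemma theta_minus_1_mult_eulerF:
  assumes "m > 0"
  shows "theta m (-1) * eulerF m = eulerE m"
proof -
  have "theta m (-1) * eulerF m = eulerO m * eulerE (2 * m) * (eulerO m * eulerF m)"
    unfolding theta_minus_1[OF assms] power2_eq_square by (simp only: mult_ac)
  then show ?thesis
    unfolding eulerO_mult_eulerF[OF assms] eulerO_mult_eulerE[OF assms] by simp
qed

section \<open>Primitive cube roots of unity\<close>

lemma root3_nonzero: "(w::complex)\<^sup>2 + w + 1 = 0 \<Longrightarrow> w \<noteq> 0"
  by auto

lemma root3_square:
  assumes "(w::complex)\<^sup>2 + w + 1 = 0"
  shows "w * w = - w - 1"
proof -
  have "w * w = - (w + 1)"
    using assms unfolding eq_neg_iff_add_eq_0 power2_eq_square by (simp add: add.assoc)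
  then show ?thesis by simp
qed

lemma root3_inverse:
  assumes "(w::complex)\<^sup>2 + w + 1 = 0"
  shows "inverse w = - 1 - w"
proof (rule inverse_unique)
  show "w * (- 1 - w) = 1" using root3_square[OF assms] by (simp add: right_diff_distrib)
qed

lemma root3_factorization:
  assumes w: "(w::complex)\<^sup>2 + w + 1 = 0"
  shows "(1 - fps_const w * u) * (1 - fps_const (inverse w) * u) * (1 - u) = 1 - u ^ 3"
proof -
  define W where "W = fps_const w"
  have "fps_const (w * w) = fps_const (- w - 1)" using root3_square[OF w] by simp
  then have W: "W * W = - W - 1"
    by (simp add: W_def flip: fps_const_neg fps_const_sub fps_const_mult)
  have W': "fps_const (inverse w) = - 1 - W"
    using root3_inverse[OF w] by (simp add: W_def flip: fps_const_neg fps_const_sub)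
  have "(1 - fps_const w * u) * (1 - fps_const (inverse w) * u) = 1 + u - (W + W * W) * u * u"
    unfolding W' W_def[symmetric] by (simp add: algebra_simps)
  also have "\<dots> = 1 + u + u * u" unfolding W by (simp add: algebra_simps)
  finally show ?thesis by (simp add: algebra_simps power3_eq_cube)
qed

text \<open>At z = -w each pair of factors is (1 - u^3)/(1 - u) with u an odd power of t;
  multiplication by \<open>eulerO 1\<close> supplies the missing factors 1 - u.\<close>

lemma theta_minus_root3:
  assumes w: "w\<^sup>2 + w + 1 = 0"
  shows "theta 1 (-w) * eulerO 1 = eulerE 2 * eulerO 3"
proof -
  have eq: "((1 + fps_const (-w) * u) * (1 + fps_const (inverse (-w)) * u)) * (1 - u) = 1 - u ^ 3" for u
    using root3_factorization[OF w, of u] by (simp add: inverse_minus_eq flip: fps_const_neg)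
  let ?p = "\<lambda>N. (\<Prod>i<N. 1 - fps_X ^ (2 * 1 * Suc i)) *
         (\<Prod>i<N. (1 + fps_const (- w) * fps_X ^ (1 * (2 * i + 1))) *
                  (1 + fps_const (inverse (- w)) * fps_X ^ (1 * (2 * i + 1))))"
  let ?o = "\<lambda>i. 1 - fps_X ^ (1 * (2 * i + 1)) :: complex fps"
  have "(\<lambda>N. ?p N * (\<Prod>i<N. ?o i)) \<longlonglongrightarrow> theta 1 (-w) * eulerO 1"
    unfolding eulerO_def
    by (intro tendsto_mult_fps jacobi_triple_theta tendsto_fps_prodinf euler_converges) (use root3_nonzero[OF w] in auto)
  moreover have "?p N * (\<Prod>i<N. ?o i) = (\<Prod>i<N. 1 - fps_X ^ (2 * Suc i)) * (\<Prod>i<N. 1 - fps_X ^ (3 * (2 * i + 1)))" for N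
  proof -
    let ?u = "\<lambda>i. fps_X ^ (1 * (2 * i + 1)) :: complex fps"
    have u3: "?u i ^ 3 = fps_X ^ (3 * (2 * i + 1))" for i
      unfolding power_mult[symmetric] mult_1_left by (simp only: mult.commute)
    have "?p N * (\<Prod>i<N. ?o i) = (\<Prod>i<N. 1 - fps_X ^ (2 * 1 * Suc i)) *
        (\<Prod>i<N. ((1 + fps_const (-w) * ?u i) * (1 + fps_const (inverse (-w)) * ?u i)) * (1 - ?u i))"
      by (simp only: mult.assoc prod.distrib)
    also have "\<dots> = (\<Prod>i<N. 1 - fps_X ^ (2 * Suc i)) * (\<Prod>i<N. 1 - fps_X ^ (3 * (2 * i + 1)))"
      unfolding eq u3 mult_1_right ..
    finally show ?thesis .
  qed
  moreover have "(\<lambda>N. (\<Prod>i<N. 1 - fps_X ^ (2 * Suc i)) * (\<Prod>i<N. 1 - fps_X ^ (3 * (2 * i + 1)))) \<longlonglongrightarrow> eulerE 2 * eulerO 3"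
    unfolding eulerO_def eulerE_def
    by (intro tendsto_mult_fps jacobi_triple_theta tendsto_fps_prodinf euler_converges) auto
  ultimately show ?thesis using LIMSEQ_unique by (metis (no_types, lifting) ext)
qed

lemma theta_mult_nth:
  assumes "m > 0" "m' > 0"
  shows "(theta m z * theta m' w) $ n = (\<Sum>(x, y) | int m * x\<^sup>2 + int m' * y\<^sup>2 = int n. z powi x * w powi y)"
proof -
  have "(theta m z * theta m' w) $ n = (\<Sum>k\<le>n. \<Sum>(x, y)\<in>{x. int m * x\<^sup>2 = int k} \<times> {y. int m' * y\<^sup>2 = int (n - k)}. z powi x * w powi y)"
    unfolding fps_mult_nth atLeast0AtMost
  proof (rule sum.cong[OF refl])
    fix k
    show "theta m z $ k * theta m' w $ (n - k) = (\<Sum>(x, y)\<in>{x. int m * x\<^sup>2 = int k} \<times> {y. int m' * y\<^sup>2 = int (n - k)}. z powi x * w powi y)"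
      unfolding theta_def fps_nth_Abs_fps sum_product by (rule sum.cartesian_product)
  qed
  also have "\<dots> = (\<Sum>(k, x, y)\<in>(SIGMA k:{..n}. {x. int m * x\<^sup>2 = int k} \<times> {y. int m' * y\<^sup>2 = int (n - k)}). z powi x * w powi y)"
    by (rule sum.Sigma) (intro finite_atMost ballI finite_cartesian_product finite_square_roots assms)+
  also have "\<dots> = (\<Sum>(x, y) | int m * x\<^sup>2 + int m' * y\<^sup>2 = int n. z powi x * w powi y)"
  proof (rule sum.reindex_bij_witness[of _ "\<lambda>(x, y). (nat (int m * x\<^sup>2), x, y)" "\<lambda>(k, x, y). (x, y)"])
    fix p assume "p \<in> {(x, y). int m * x\<^sup>2 + int m' * y\<^sup>2 = int n}"
    then obtain x y where p: "p = (x, y)" "int m * x\<^sup>2 + int m' * y\<^sup>2 = int n" by auto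
    have "0 \<le> int m * x\<^sup>2" "0 \<le> int m' * y\<^sup>2" by simp_all
    then obtain a b where ab: "int m * x\<^sup>2 = int a" "int m' * y\<^sup>2 = int b"
      using zero_le_imp_eq_int by metis
    then have "n = a + b" using p(2) by simp
    then show "(case p of (x, y) \<Rightarrow> (nat (int m * x\<^sup>2), x, y)) \<in> (SIGMA k:{..n}. {x. int m * x\<^sup>2 = int k} \<times> {y. int m' * y\<^sup>2 = int (n - k)})"
      using ab unfolding p(1) by simp
  qed auto
  finally show ?thesis .
qed

subsection \<open>Evaluation of the generating function\<close>

definition int_poly_eval :: "complex \<Rightarrow> int poly \<Rightarrow> complex" where
  "int_poly_eval z p = poly (map_poly of_int p) z"

lemma int_poly_eval_pCons [simp]: "int_poly_eval z (pCons a p) = of_int a + z * int_poly_eval z p"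
  by (simp add: int_poly_eval_def map_poly_pCons)

lemma int_poly_eval_0 [simp]: "int_poly_eval z 0 = 0"
  by (simp add: int_poly_eval_def)

lemma int_poly_eval_1 [simp]: "int_poly_eval z 1 = 1"
  by (simp add: int_poly_eval_def)

lemma int_poly_eval_add: "int_poly_eval z (p + q) = int_poly_eval z p + int_poly_eval z q"
  by (induction p q rule: poly_induct2) (simp_all add: algebra_simps)

lemma int_poly_eval_smult: "int_poly_eval z (smult c p) = of_int c * int_poly_eval z p"
  by (induction p) (simp_all add: algebra_simps)

lemma int_poly_eval_mult: "int_poly_eval z (p * q) = int_poly_eval z p * int_poly_eval z q"
  by (induction p) (simp_all add: algebra_simps int_poly_eval_add int_poly_eval_smult)

lemma int_poly_eval_power: "int_poly_eval z (p ^ n) = int_poly_eval z p ^ n"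
  by (induction n) (simp_all add: int_poly_eval_mult)

text \<open>
  Substituting \<open>q = z\<close> is not defined on the whole field of fractions, so it is treated as a
  relation, which is functional on Laurent polynomials because \<open>z \<noteq> 0\<close>.
\<close>

definition laurent_rel :: "complex \<Rightarrow> int poly fract \<Rightarrow> complex \<Rightarrow> bool" where
  "laurent_rel z a b \<longleftrightarrow> (\<exists>p k. a = to_fract p / qvar ^ k \<and> b = int_poly_eval z p / z ^ k)"

lemma to_fract_power: "to_fract p ^ k = to_fract (p ^ k)"
  by (induction k) simp_all

lemma laurent_rel_unique:
  assumes "z \<noteq> 0" "laurent_rel z a b" "laurent_rel z a b'"
  shows "b = b'"
proof -
  obtain p k p' k' where *: "a = to_fract p / qvar ^ k" "b = int_poly_eval z p / z ^ k"
    "a = to_fract p' / qvar ^ k'" "b' = int_poly_eval z p' / z ^ k'"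
    using assms unfolding laurent_rel_def by blast
  have "to_fract p * qvar ^ k' = to_fract p' * qvar ^ k"
    using *(1,3) by (simp add: frac_eq_eq)
  then have "to_fract (p * [:0, 1:] ^ k') = to_fract (p' * [:0, 1:] ^ k)"
    by (simp only: qvar_def to_fract_power to_fract_mult)
  then have "p * [:0, 1:] ^ k' = p' * [:0, 1:] ^ k" by (simp only: to_fract_eq_iff)
  then have "int_poly_eval z (p * [:0, 1:] ^ k') = int_poly_eval z (p' * [:0, 1:] ^ k)" by simp
  then show ?thesis
    using assms(1) *(2,4) by (simp add: int_poly_eval_mult int_poly_eval_power frac_eq_eq)
qed

lemma laurent_rel_add:
  assumes "z \<noteq> 0" "laurent_rel z a b" "laurent_rel z a' b'"
  shows "laurent_rel z (a + a') (b + b')"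
proof -
  obtain p k p' k' where *: "a = to_fract p / qvar ^ k" "b = int_poly_eval z p / z ^ k"
    "a' = to_fract p' / qvar ^ k'" "b' = int_poly_eval z p' / z ^ k'"
    using assms unfolding laurent_rel_def by blast
  have "a + a' = to_fract (p * [:0, 1:] ^ k' + p' * [:0, 1:] ^ k) / qvar ^ (k + k')"
    unfolding *(1,3) power_add to_fract_add to_fract_mult to_fract_power[symmetric] qvar_def[symmetric]
    by (simp add: add_frac_eq)
  moreover have "b + b' = int_poly_eval z (p * [:0, 1:] ^ k' + p' * [:0, 1:] ^ k) / z ^ (k + k')"
    using assms(1) *(2,4) by (simp add: int_poly_eval_mult int_poly_eval_power int_poly_eval_add add_frac_eq power_add)
  ultimately show ?thesis unfolding laurent_rel_def by blast
qed

lemma laurent_rel_mult: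
  assumes "laurent_rel z a b" "laurent_rel z a' b'"
  shows "laurent_rel z (a * a') (b * b')"
proof -
  obtain p k p' k' where *: "a = to_fract p / qvar ^ k" "b = int_poly_eval z p / z ^ k"
    "a' = to_fract p' / qvar ^ k'" "b' = int_poly_eval z p' / z ^ k'"
    using assms unfolding laurent_rel_def by blast
  have "a * a' = to_fract (p * p') / qvar ^ (k + k')" "b * b' = int_poly_eval z (p * p') / z ^ (k + k')"
    unfolding * power_add to_fract_mult int_poly_eval_mult by simp_all
  then show ?thesis unfolding laurent_rel_def by blast
qed

lemma laurent_rel_of_int: "laurent_rel z (of_int c) (of_int c)"
  unfolding laurent_rel_def
proof (intro exI conjI)
  have "of_int c = to_fract [:c:]"
  proof (induction c)
    case (nonneg n)
    show ?case by (induction n) (auto simp: one_pCons simp flip: to_fract_1 to_fract_add)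
  next
    case (neg n)
    have "of_nat n = to_fract [:int n:]" for n
      by (induction n) (auto simp: one_pCons simp flip: to_fract_1 to_fract_add)
    from this[of "Suc n"] have "of_int (- int (Suc n)) = - to_fract [:int (Suc n):]"
      by (simp only: of_int_minus of_int_of_nat_eq)
    also have "\<dots> = to_fract [:- int (Suc n):]"
      unfolding to_fract_uminus[symmetric] by simp
    finally show ?case .
  qed
  then show "of_int c = to_fract [:c:] / qvar ^ 0" by simp
qed simp

lemma laurent_rel_qvar: "z \<noteq> 0 \<Longrightarrow> laurent_rel z (qvar + inverse qvar) (z + inverse z)"
proof (rule laurent_rel_add)
  have "laurent_rel z (to_fract [:0,1:] / qvar ^ 0) (int_poly_eval z [:0,1:] / z ^ 0)"
    "laurent_rel z (to_fract 1 / qvar ^ 1) (int_poly_eval z 1 / z ^ 1)"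
    unfolding laurent_rel_def by blast+
  then show "laurent_rel z qvar z" "laurent_rel z (inverse qvar) (inverse z)"
    by (simp_all add: inverse_eq_divide flip: qvar_def)
qed

definition laurent_fps_rel :: "complex \<Rightarrow> int poly fract fps \<Rightarrow> complex fps \<Rightarrow> bool" where
  "laurent_fps_rel z A B \<longleftrightarrow> (\<forall>n. laurent_rel z (A $ n) (B $ n))"

lemma laurent_rel_sum:
  assumes "z \<noteq> 0" "\<And>x. x \<in> S \<Longrightarrow> laurent_rel z (f x) (g x)"
  shows "laurent_rel z (sum f S) (sum g S)"
  using assms(2)
  by (induction S rule: infinite_finite_induct)
     (auto intro: laurent_rel_add[OF assms(1)] laurent_rel_of_int[of z 0, simplified])

lemma laurent_fps_rel_mult:
  assumes "z \<noteq> 0" "laurent_fps_rel z A B" "laurent_fps_rel z A' B'"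
  shows "laurent_fps_rel z (A * A') (B * B')"
  using assms unfolding laurent_fps_rel_def fps_mult_nth
  by (auto intro!: laurent_rel_sum laurent_rel_mult)

lemma laurent_fps_rel_prod:
  assumes "z \<noteq> 0" "\<And>x. x \<in> S \<Longrightarrow> laurent_fps_rel z (f x) (g x)"
  shows "laurent_fps_rel z (prod f S) (prod g S)"
proof -
  have "laurent_fps_rel z 1 1"
    using laurent_rel_of_int[of z 1] laurent_rel_of_int[of z 0] by (auto simp: laurent_fps_rel_def fps_one_nth)
  then show ?thesis
    using assms(2)
    by (induction S rule: infinite_finite_induct) (auto intro: laurent_fps_rel_mult[OF assms(1)])
qed

lemma laurent_fps_rel_unique:
  assumes "z \<noteq> 0" "laurent_fps_rel z A B" "laurent_fps_rel z A B'"
  shows "B = B'"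
  using assms laurent_rel_unique[OF assms(1)] unfolding laurent_fps_rel_def by (metis fps_ext)

section \<open>The generating function after substitution\<close>

definition C_series :: "complex \<Rightarrow> complex fps" where
  "C_series z = Abs_fps (\<lambda>n. if n = 0 then 1 else C_at n z / z ^ n)"

text \<open>The denominator depends on q only through s = q + 1/q, and a general ring lets one
  expression serve before and after the substitution. At -1, w, i and -w the value of s is -2, -1, 0
  and 1.\<close>

definition C_den :: "'a::comm_ring_1 \<Rightarrow> nat \<Rightarrow> 'a fps" where
  "C_den s i = 1 - fps_const s * fps_X ^ i + fps_X ^ (2 * i)"

lemma C_den_altdef:
  "C_den s i = fps_const 1 * fps_X ^ 0 + fps_const (- 1 * s) * fps_X ^ i + fps_const 1 * fps_X ^ (2 * i)"
  unfolding C_den_def by (simp del: fps_const_neg add: fps_const_neg[symmetric])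

lemma C_factor_mult_den:
  assumes "i > 0"
  shows "C_factor i * C_den (qvar + inverse qvar) i = (1 - fps_X ^ i)\<^sup>2"
proof -
  have D: "C_den (qvar + inverse qvar) i $ 0 = 1" using assms by (simp add: C_den_def)
  then have "C_factor i = (1 - fps_X ^ i)\<^sup>2 * inverse (C_den (qvar + inverse qvar) i)"
    unfolding C_factor_def C_den_def[symmetric] by (simp add: fps_divide_unit)
  then show ?thesis using D by (simp add: mult.assoc inverse_mult_eq_1)
qed

lemma C_den_converges: "fps_prod_converges (\<lambda>i. C_den s (Suc i))"
  unfolding fps_prod_converges_def C_den_def by (auto simp: fps_X_power_nth)

text \<open>The numerator is the denominator at q = 1, where s = 2.\<close>

lemma C_num_converges: "fps_prod_converges (\<lambda>i. (1 - fps_X ^ Suc i)\<^sup>2 :: 'a::comm_ring_1 fps)"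
proof -
  have "(1 - x)\<^sup>2 = 1 - 2 * x + x ^ 2" for x :: "'a fps" by (simp add: power2_eq_square algebra_simps)
  then have "(1 - fps_X ^ Suc i :: 'a fps)\<^sup>2 = C_den 2 (Suc i)" for i
    unfolding C_den_def by (simp only: power_mult[symmetric] mult.commute numeral_fps_const)
  then show ?thesis using C_den_converges[of "2::'a"] by (simp only:)
qed

text \<open>The substitution is made in the relation between N factors, their denominators and their
  numerators, all of which have Laurent polynomial coefficients. Both sides are then related to the
  same series, and uniqueness of the evaluation gives the complex identity; N tends to infinity
  afterwards.\<close>

lemma C_series_mult_den:
  assumes z: "z \<noteq> 0"
  shows "C_series z * fps_prodinf (\<lambda>i. C_den (z + inverse z) (Suc i)) = eulerE 1 ^ 2"
proof -
  let ?D = "\<lambda>N. \<Prod>i<N. C_den (z + inverse z) (Suc i)"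
  have "\<exists>S. (\<forall>k<N. S $ k = C_series z $ k) \<and> S * ?D N = (\<Prod>i<N. (1 - fps_X ^ Suc i)\<^sup>2)" for N
  proof -
    define A where "A = (\<Prod>i<N. C_factor (Suc i))"
    \<comment> \<open>This property is what makes every coefficient of the truncated product a
      Laurent polynomial.\<close>
    have A: "C_like A"
      unfolding A_def by (induction N) (simp_all add: C_like_1 C_like_mult C_like_factor(1))
    have "\<exists>p. A $ k = to_fract p / qvar ^ k" for k
    proof (cases "k = 0")
      case True
      then show ?thesis using C_like_nth_0[OF A] by (intro exI[of _ 1]) simp
    next
      case False
      then show ?thesis using C_like_nth[OF A, of k] by (metis less_one linorder_not_less)
    qed
    then obtain p where p: "A $ k = to_fract (p k) / qvar ^ k" for k by metis
    define S where "S = Abs_fps (\<lambda>k. int_poly_eval z (p k) / z ^ k)"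
    have AS: "laurent_fps_rel z A S"
      unfolding laurent_fps_rel_def laurent_rel_def using p by (auto simp: S_def)
    have const: "laurent_rel z 0 0" "laurent_rel z 1 1" "laurent_rel z (-1) (-1)"
      using laurent_rel_of_int[of z 0] laurent_rel_of_int[of z 1] laurent_rel_of_int[of z "-1"] by simp_all
    have lfr_add: "laurent_fps_rel z (A + A') (B + B')" if "laurent_fps_rel z A B" "laurent_fps_rel z A' B'" for A A' B B'
      using that laurent_rel_add[OF z] by (auto simp: laurent_fps_rel_def)
    have lfr_X: "laurent_fps_rel z (fps_const c * fps_X ^ i) (fps_const d * fps_X ^ i)" if "laurent_rel z c d" for c d i
      unfolding laurent_fps_rel_def fps_mult_left_const_nth fps_X_power_nth using that const by auto
    have "laurent_fps_rel z (C_den (qvar + inverse qvar) i) (C_den (z + inverse z) i)" for i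
    proof -
      have "laurent_rel z (- 1 * (qvar + inverse qvar)) (- 1 * (z + inverse z))"
        by (rule laurent_rel_mult[OF const(3) laurent_rel_qvar[OF z]])
      then have "laurent_fps_rel z (fps_const 1 * fps_X ^ 0 + fps_const (- 1 * (qvar + inverse qvar)) * fps_X ^ i + fps_const 1 * fps_X ^ (2 * i))
        (fps_const 1 * fps_X ^ 0 + fps_const (- 1 * (z + inverse z)) * fps_X ^ i + fps_const 1 * fps_X ^ (2 * i))"
        by (intro lfr_add lfr_X const)
      then show ?thesis by (simp only: C_den_altdef)
    qed
    then have "laurent_fps_rel z (A * (\<Prod>i<N. C_den (qvar + inverse qvar) (Suc i))) (S * ?D N)"
      by (intro laurent_fps_rel_mult laurent_fps_rel_prod AS z)
    moreover have "A * (\<Prod>i<N. C_den (qvar + inverse qvar) (Suc i)) = (\<Prod>i<N. (1 - fps_X ^ Suc i)\<^sup>2)"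
      unfolding A_def prod.distrib[symmetric] by (intro prod.cong refl C_factor_mult_den) simp
    moreover have "laurent_fps_rel z (\<Prod>i<N. (1 - fps_X ^ Suc i)\<^sup>2) (\<Prod>i<N. (1 - fps_X ^ Suc i)\<^sup>2)"
    proof (intro laurent_fps_rel_prod z)
      fix i
      have "laurent_fps_rel z (fps_const 1 * fps_X ^ 0 + fps_const (-1) * fps_X ^ Suc i) (fps_const 1 * fps_X ^ 0 + fps_const (-1) * fps_X ^ Suc i)"
        by (intro lfr_add lfr_X const)
      then have "laurent_fps_rel z (1 - fps_X ^ Suc i) (1 - fps_X ^ Suc i)"
        by (simp only: fps_const_neg[symmetric] fps_const_1_eq_1 power_0 mult_1_left mult_minus_left diff_conv_add_uminus)
      then show "laurent_fps_rel z ((1 - fps_X ^ Suc i)\<^sup>2) ((1 - fps_X ^ Suc i)\<^sup>2)"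
        unfolding power2_eq_square by (intro laurent_fps_rel_mult z)
    qed
    ultimately have "S * ?D N = (\<Prod>i<N. (1 - fps_X ^ Suc i)\<^sup>2)"
      using laurent_fps_rel_unique[OF z] by metis
    moreover have "S $ k = C_series z $ k" if kN: "k < N" for k
    proof (cases "k = 0")
      case True
      have "laurent_rel z (A $ 0) (S $ 0)" using AS by (simp add: laurent_fps_rel_def)
      then show ?thesis
        using True C_like_nth_0[OF A] laurent_rel_unique[OF z _ const(2)] by (simp add: C_series_def)
    next
      case False
      obtain M where M: "N = Suc M" using kN by (cases N) auto
      have "A $ k = (\<Prod>i. C_factor (Suc i)) $ k"
        using partial_prod_stable[of k M] kN by (simp add: A_def M lessThan_Suc_atMost prodinf_nth)
      also have "\<dots> = to_fract (C_poly k) / qvar ^ k"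
        using C_poly_nth(1)[of k] False by simp
      finally have "to_fract (C_poly k) = to_fract (p k)" unfolding p by simp
      then show ?thesis using False by (simp add: S_def C_series_def C_at_def int_poly_eval_def)
    qed
    ultimately show ?thesis by blast
  qed
  then obtain S where S: "\<And>N k. k < N \<Longrightarrow> S N $ k = C_series z $ k" "\<And>N. S N * ?D N = (\<Prod>i<N. (1 - fps_X ^ Suc i)\<^sup>2)"
    by metis
  have "S \<longlonglongrightarrow> C_series z"
  proof (rule tendsto_fpsI)
    fix k show "\<forall>\<^sub>F N in sequentially. S N $ k = C_series z $ k"
      using eventually_gt_at_top[of k] by eventually_elim (rule S(1))
  qed
  then have "(\<lambda>N. S N * ?D N) \<longlonglongrightarrow> C_series z * fps_prodinf (\<lambda>i. C_den (z + inverse z) (Suc i))"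
    by (intro tendsto_mult_fps tendsto_fps_prodinf C_den_converges)
  then have "C_series z * fps_prodinf (\<lambda>i. C_den (z + inverse z) (Suc i)) = fps_prodinf (\<lambda>i. (1 - fps_X ^ Suc i)\<^sup>2)"
    unfolding S(2) using tendsto_fps_prodinf[OF C_num_converges] LIMSEQ_unique by blast
  also have "\<dots> = eulerE 1 * eulerE 1"
    unfolding eulerE_def
    by (rule fps_prodinf_mult[symmetric]) (use euler_converges(1)[of 1] C_num_converges in \<open>simp_all add: power2_eq_square\<close>)
  finally show ?thesis by (simp add: power2_eq_square)
qed

subsection \<open>The values at \<open>-1\<close>, \<open>\<i>\<close> and \<open>-j\<close>\<close>

lemma P_at_mult:
  assumes "n \<ge> 1"
  shows "P_at n z * (z - 1)\<^sup>2 = C_at n z"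
proof -
  have "int_poly_eval z (P_poly n * [:-1, 1:]\<^sup>2) = int_poly_eval z (C_poly n)"
    using P_poly_mult[OF assms] by simp
  then show ?thesis
    by (simp add: int_poly_eval_mult int_poly_eval_power P_at_def C_at_def algebra_simps flip: int_poly_eval_def)
qed

lemma C_at_eq_nth:
  assumes "n \<ge> 1" "z \<noteq> 0"
  shows "C_at n z = C_series z $ n * z ^ n"
  using assms by (simp add: C_series_def)

lemma minus_one_powi: "(-1) powi x = (if even x then 1 else -1 :: complex)"
  by (simp add: power_int_minus_left)

lemma square_parity: "even ((x::int)\<^sup>2) \<longleftrightarrow> even x"
  by simp

text \<open>For s = -2 the denominator is (1 + t^i)^2, so the series is (E(1)/F(1))^2, and E(1)/F(1)
  is the alternating theta series.\<close>

lemma C_series_minus_1: "C_series (-1) = theta 1 (-1) * theta 1 (-1)"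
proof -
  have "fps_prodinf (\<lambda>i. C_den (-2) (Suc i)) = eulerF 1 * eulerF 1"
    unfolding eulerF_def
  proof (rule fps_prodinf_mult[symmetric])
    show "(1 + fps_X ^ (1 * Suc i)) * (1 + fps_X ^ (1 * Suc i)) = (C_den (-2) (Suc i) :: complex fps)" for i
    proof -
      have "(1 + x) * (1 + x) = 1 - (-2) * x + x ^ 2" for x :: "complex fps"
        by (simp add: power2_eq_square algebra_simps)
      moreover have "fps_const (-2 :: complex) = -2" by (simp add: numeral_fps_const flip: fps_const_neg)
      ultimately show ?thesis unfolding C_den_def by (simp only: power_mult[symmetric] mult.commute mult_1_right mult_1_left)
    qed
  qed (use C_den_converges euler_converges(2)[of 1] in auto)
  then have "C_series (-1) * (eulerF 1 * eulerF 1) = (eulerF 1 * eulerF 1) * (theta 1 (-1) * theta 1 (-1))"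
    using C_series_mult_den[of "-1"] theta_minus_1_mult_eulerF[of 1]
    by (simp add: power2_eq_square) (simp add: mult_ac)
  then have "(eulerF 1 * eulerF 1) * C_series (-1) = (eulerF 1 * eulerF 1) * (theta 1 (-1) * theta 1 (-1))"
    by (simp only: mult.commute)
  moreover have "eulerF 1 * eulerF 1 \<noteq> 0" using euler_nonzero(2)[of 1] by simp
  ultimately show ?thesis by (rule mult_left_cancel[THEN iffD1, rotated])
qed

text \<open>Since x + y has the parity of x^2 + y^2, all representations carry the sign (-1)^n, and
  the factor z^n cancels it.\<close>

lemma C_at_minus_1:
  assumes "n \<ge> 1"
  shows "C_at n (-1) = of_nat (r_count n)"
proof -
  have "C_series (-1) $ n = (\<Sum>(x, y) | x\<^sup>2 + y\<^sup>2 = int n. (-1) powi x * (-1) powi y)"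
    unfolding C_series_minus_1 by (subst theta_mult_nth) auto
  also have "\<dots> = (\<Sum>(x, y) | x\<^sup>2 + y\<^sup>2 = int n. (-1) ^ n)"
  proof (intro sum.cong refl, clarify)
    fix x y :: int assume "x\<^sup>2 + y\<^sup>2 = int n"
    then have "even n \<longleftrightarrow> even (x + y)"
      by (metis even_add even_of_nat_iff square_parity)
    then show "(- 1) powi x * (- 1) powi y = (- 1 :: complex) ^ n"
      by (auto simp: minus_one_powi)
  qed
  also have "\<dots> = of_nat (r_count n) * (-1) ^ n"
    by (simp add: r_count_def)
  finally show ?thesis using C_at_eq_nth[OF assms, of "-1"] by (simp flip: power_add mult_2)
qed

text \<open>For s = 0 the denominators are 1 + t^(2i). The square E(1)^2 becomes divisible by F(2)
  on writing E(1) F(1) = E(2) and E(2) as theta(-1)(t^2) F(2).\<close>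

lemma C_series_i: "C_series \<i> = theta 1 (-1) * theta 2 (-1)"
proof -
  have "fps_prodinf (\<lambda>i. C_den 0 (Suc i)) = eulerF 2"
    unfolding eulerF_def C_den_def by simp
  then have "eulerF 2 * C_series \<i> = eulerE 1 ^ 2"
    using C_series_mult_den[of \<i>] by (simp add: mult.commute)
  also have "\<dots> = eulerF 2 * (theta 1 (-1) * theta 2 (-1))"
  proof -
    have "eulerF 2 * (theta 1 (-1) * theta 2 (-1)) = theta 1 (-1) * (theta 2 (-1) * eulerF 2)"
      by (simp only: mult_ac)
    also have "\<dots> = theta 1 (-1) * (eulerE 1 * eulerF 1)"
      using theta_minus_1_mult_eulerF[of 2] eulerE_mult_eulerF[of 1] by simp
    also have "\<dots> = eulerE 1 * (theta 1 (-1) * eulerF 1)" by (simp only: mult_ac)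
    also have "\<dots> = eulerE 1 ^ 2"
      using theta_minus_1_mult_eulerF[of 1] by (simp add: power2_eq_square)
    finally show ?thesis ..
  qed
  finally show ?thesis using euler_nonzero(2)[of 2] by (rule mult_left_cancel[THEN iffD1, rotated])
qed

text \<open>This is the origin of the floor function in the sign. With x = 2a or x = 2a + 1, halving
  n + 1 leaves y^2 plus an even number or y^2 plus an odd number.\<close>

lemma parity_square_plus_double_square:
  fixes x y :: int
  assumes "x\<^sup>2 + 2 * y\<^sup>2 = int n"
  shows "even ((n + 1) div 2) \<longleftrightarrow> even (x + y)"
proof -
  have "int ((n + 1) div 2) = (int n + 1) div 2" by simp
  also have "even \<dots> \<longleftrightarrow> even (x + y)"
  proof (cases "even x")
    case True
    then obtain a where a: "x = 2 * a" by blast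
    have "int n + 1 = 1 + 2 * (2 * a\<^sup>2 + y\<^sup>2)" using assms by (simp add: a power_mult_distrib)
    then have "(int n + 1) div 2 = 2 * a\<^sup>2 + y\<^sup>2" by presburger
    then show ?thesis using a by simp
  next
    case False
    then obtain a where a: "x = 2 * a + 1" by (rule oddE)
    have "int n + 1 = 2 * (2 * a\<^sup>2 + 2 * a + 1 + y\<^sup>2)"
      using assms by (simp add: a power2_eq_square algebra_simps)
    then have "(int n + 1) div 2 = 2 * a\<^sup>2 + 2 * a + 1 + y\<^sup>2" by presburger
    then show ?thesis using a by simp
  qed
  finally show ?thesis by simp
qed

lemma C_at_i:
  assumes "n \<ge> 1"
  shows "C_at n \<i> = (-1) ^ ((n + 1) div 2) * of_nat (r'_count n) * \<i> ^ n"
proof -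
  have "C_series \<i> $ n = (\<Sum>(x, y) | x\<^sup>2 + 2 * y\<^sup>2 = int n. (-1) powi x * (-1) powi y)"
    unfolding C_series_i by (subst theta_mult_nth) auto
  also have "\<dots> = (\<Sum>(x, y) | x\<^sup>2 + 2 * y\<^sup>2 = int n. (-1) ^ ((n + 1) div 2))"
  proof (intro sum.cong refl, clarify)
    fix x y :: int assume "x\<^sup>2 + 2 * y\<^sup>2 = int n"
    from parity_square_plus_double_square[OF this]
    show "(- 1) powi x * (- 1) powi y = (- 1 :: complex) ^ ((n + 1) div 2)"
      by (cases "even ((n + 1) div 2)") (auto simp: minus_one_powi)
  qed
  also have "\<dots> = (-1) ^ ((n + 1) div 2) * of_nat (r'_count n)"
    by (simp add: r'_count_def)
  finally show ?thesis using C_at_eq_nth[OF assms, of "\<i>"] by simp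
qed

lemma P_at_i:
  assumes "n \<ge> 1"
  shows "P_at n \<i> = (-1) ^ ((n - 1) div 2) * (of_nat (r'_count n) / 2) * \<i> ^ (n - 1)"
proof -
  obtain m where m: "n = Suc m" using assms by (cases n) auto
  have "(\<i> - 1)\<^sup>2 = - 2 * \<i>" by (simp add: power2_diff)
  then have "P_at n \<i> * (- 2 * \<i>) = C_at n \<i>" using P_at_mult[OF assms] by metis
  \<comment> \<open>Here (n + 1) div 2 = m div 2 + 1, and this extra sign cancels the one in (i -
    1)^2 = -2i.\<close>
  also have "\<dots> = ((-1) ^ (m div 2) * (of_nat (r'_count n) / 2) * \<i> ^ m) * (- 2 * \<i>)"
    unfolding C_at_i[OF assms] by (simp add: m)
  finally have "P_at n \<i> = (-1) ^ (m div 2) * (of_nat (r'_count n) / 2) * \<i> ^ m"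
    by (subst (asm) mult_right_cancel) auto
  then show ?thesis by (simp add: m)
qed

text \<open>For s = 1 the denominator is (1 + t^(3i)) / (1 + t^i), whence the series is E(1)^2 F(1)
  / F(3). The theta product times F(3) reduces to the same numerator because O(3) F(3) = 1.\<close>

lemma C_series_minus_root3:
  assumes w: "w\<^sup>2 + w + 1 = 0"
  shows "C_series (-w) = theta 1 (-1) * theta 1 (-w)"
proof -
  note w0 = root3_nonzero[OF w] and inv = root3_inverse[OF w]
  define D where "D = fps_prodinf (\<lambda>i. C_den (1::complex) (Suc i))"
  have D: "D * eulerF 1 = eulerF 3"
    unfolding D_def eulerF_def
  proof (rule fps_prodinf_mult)
    have "(1 - x + x ^ 2) * (1 + x) = 1 + x ^ 3" for x :: "complex fps"
      by (simp add: power2_eq_square power3_eq_cube algebra_simps)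
    then have "(1 - fps_X ^ k + (fps_X ^ k)\<^sup>2) * (1 + fps_X ^ k) = (1 + (fps_X ^ k) ^ 3 :: complex fps)" for k
      by blast
    then show "C_den 1 (Suc i) * (1 + fps_X ^ (1 * Suc i)) = (1 + fps_X ^ (3 * Suc i) :: complex fps)" for i
      by (simp only: C_den_def fps_const_1_eq_1 mult_1_left power_mult[symmetric] mult.commute mult_1_right)
  qed (use C_den_converges euler_converges(2)[of 1] euler_converges(2)[of 3] in auto)
  have "-w + inverse (-w) = 1" using inv by simp
  then have "C_series (-w) * D = eulerE 1 ^ 2"
    using C_series_mult_den[of "-w"] w0 by (simp add: D_def)
  then have 1: "C_series (-w) * eulerF 3 = eulerE 1 ^ 2 * eulerF 1"
    unfolding D[symmetric] by (simp only: mult.assoc[symmetric])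
  have "theta 1 (-w) * (eulerO 1 * eulerF 1) = eulerE 2 * eulerO 3 * eulerF 1"
    using theta_minus_root3[OF w] by (simp only: mult.assoc[symmetric])
  then have "theta 1 (-w) = eulerE 2 * eulerO 3 * eulerF 1"
    unfolding eulerO_mult_eulerF[OF zero_less_one] mult_1_right .
  then have "theta 1 (-1) * theta 1 (-w) * eulerF 3 = (theta 1 (-1) * eulerF 1) * eulerE 2 * (eulerO 3 * eulerF 3)"
    by (simp only: mult_ac)
  also have "\<dots> = eulerE 1 ^ 2 * eulerF 1"
    using eulerO_mult_eulerF[of 3] theta_minus_1_mult_eulerF[of 1] eulerE_mult_eulerF[of 1]
    by (simp add: power2_eq_square mult_ac)
  finally have "eulerF 3 * C_series (-w) = eulerF 3 * (theta 1 (-1) * theta 1 (-w))"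
    using 1 by (simp only: mult.commute)
  then show ?thesis using euler_nonzero(2)[of 3] by (rule mult_left_cancel[THEN iffD1, rotated])
qed

section \<open>Two squares weighted by a cube root of unity\<close>

lemma root3_cube:
  assumes "(w::complex)\<^sup>2 + w + 1 = 0"
  shows "w ^ 3 = 1"
proof -
  have "w ^ 3 - 1 = (w - 1) * (w\<^sup>2 + w + 1)" by (simp add: power2_eq_square power3_eq_cube algebra_simps)
  then show ?thesis using assms by simp
qed

lemma root3_power_mod:
  assumes "(w::complex)\<^sup>2 + w + 1 = 0"
  shows "w ^ n = w ^ (n mod 3)"
proof -
  have "w ^ n = w ^ (3 * (n div 3) + n mod 3)" by simp
  also have "\<dots> = w ^ (n mod 3)" unfolding power_add power_mult root3_cube[OF assms] by simp
  finally show ?thesis .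
qed

lemma root3_powi_mod:
  assumes "(w::complex)\<^sup>2 + w + 1 = 0"
  shows "w powi y = w powi (y mod 3)"
proof -
  have w0: "w \<noteq> 0" using assms by auto
  have "w powi y = w powi (3 * (y div 3) + y mod 3)" by simp
  also have "\<dots> = (w powi 3) powi (y div 3) * w powi (y mod 3)"
    using w0 by (simp only: power_int_add power_int_mult simp_thms)
  also have "w powi 3 = 1" using root3_cube[OF assms] by (simp add: power_int_def)
  finally show ?thesis by simp
qed

lemma root3_trace:
  assumes "(w::complex)\<^sup>2 + w + 1 = 0"
  shows "w powi y + w powi (-y) = (if 3 dvd y then 2 else -1)"
proof -
  have "y mod 3 = 0 \<and> (-y) mod 3 = 0 \<or> y mod 3 = 1 \<and> (-y) mod 3 = 2 \<or> y mod 3 = 2 \<and> (-y) mod 3 = 1"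
    by presburger
  moreover have "w + w\<^sup>2 = -1" using assms by (simp add: eq_neg_iff_add_eq_0 add_ac)
  ultimately show ?thesis
    unfolding root3_powi_mod[OF assms, of y] root3_powi_mod[OF assms, of "-y"] dvd_eq_mod_eq_0
    by (elim disjE conjE) (simp_all add: power_int_def add.commute)
qed

lemma square_mod_3: "(x::int)\<^sup>2 mod 3 = (if 3 dvd x then 0 else 1)"
proof -
  have "x\<^sup>2 mod 3 = (x mod 3)\<^sup>2 mod 3" by (simp add: power_mod)
  moreover have "x mod 3 = 0 \<or> x mod 3 = 1 \<or> x mod 3 = 2" by presburger
  ultimately show ?thesis unfolding dvd_eq_mod_eq_0 by (elim disjE) simp_all
qed

text \<open>The set of representations is stable under sign changes and the swap of coordinates.
  Averaging over four images replaces powers of w by traces, which only see whether 3 divides x and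
  y, and that is determined by n modulo 3.\<close>

lemma sum_root3_two_squares:
  fixes w :: complex
  assumes w: "w\<^sup>2 + w + 1 = 0"
  shows "(\<Sum>(x, y) | x\<^sup>2 + y\<^sup>2 = int n. w powi y) =
    (if n mod 3 = 0 then of_nat (r_count n) else if n mod 3 = 1 then of_nat (r_count n) / 4
     else - (of_nat (r_count n) / 2))"
proof -
  let ?R = "{(x::int, y::int). x\<^sup>2 + y\<^sup>2 = int n}"
  define S where "S = (\<Sum>(x, y)\<in>?R. w powi y)"
  have S: "S = (\<Sum>(x, y)\<in>?R. w powi (-y))"
    unfolding S_def by (rule sum.reindex_bij_witness[of _ "\<lambda>(x, y). (x, -y)" "\<lambda>(x, y). (x, -y)"]) auto
  have S': "S = (\<Sum>(x, y)\<in>?R. w powi x)"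
    unfolding S_def by (rule sum.reindex_bij_witness[of _ "\<lambda>(x, y). (y, x)" "\<lambda>(x, y). (y, x)"]) auto
  have S'': "S = (\<Sum>(x, y)\<in>?R. w powi (-x))"
    unfolding S_def by (rule sum.reindex_bij_witness[of _ "\<lambda>(x, y). (y, -x)" "\<lambda>(x, y). (-y, x)"]) auto
  \<comment> \<open>The values are 2 + 2, 2 - 1 and -1 - 1: both, exactly one, or none of x and y
    divisible by 3.\<close>
  define c :: complex where "c = (if n mod 3 = 0 then 4 else if n mod 3 = 1 then 1 else -2)"
  have "4 * S = (\<Sum>(x, y)\<in>?R. w powi x) + (\<Sum>(x, y)\<in>?R. w powi (-x)) + (\<Sum>(x, y)\<in>?R. w powi y) + (\<Sum>(x, y)\<in>?R. w powi (-y))"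
    unfolding S[symmetric] S'[symmetric] S''[symmetric] S_def[symmetric] by simp
  also have "\<dots> = (\<Sum>(x, y)\<in>?R. (w powi x + w powi (-x)) + (w powi y + w powi (-y)))"
    by (simp add: case_prod_beta sum.distrib)
  also have "\<dots> = (\<Sum>(x, y)\<in>?R. c)"
  proof (intro sum.cong refl, clarify)
    fix x y :: int assume "x\<^sup>2 + y\<^sup>2 = int n"
    then have "(x\<^sup>2 mod 3 + y\<^sup>2 mod 3) mod 3 = int (n mod 3)" by (simp add: mod_add_eq zmod_int)
    then show "(w powi x + w powi (-x)) + (w powi y + w powi (-y)) = c"
      unfolding root3_trace[OF w] square_mod_3 by (auto simp: c_def split: if_splits)
  qed
  also have "\<dots> = of_nat (r_count n) * c" by (simp add: r_count_def)
  finally have S_eq: "S = of_nat (r_count n) * c / 4" by (simp add: field_simps)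
  show ?thesis unfolding S_def[symmetric] S_eq by (simp add: c_def)
qed

text \<open>The common sign (-1)^n of the representations combines with (-w)^n to w^n, which is
  where the factors w and w^2 come from.\<close>

lemma C_at_minus_root3:
  assumes w: "w\<^sup>2 + w + 1 = 0" and n: "n \<ge> 1"
  shows "C_at n (-w) = (if n mod 3 = 0 then of_nat (r_count n)
           else if n mod 3 = 1 then of_nat (r_count n) / 4 * w
           else - (of_nat (r_count n) / 2) * w ^ 2)"
proof -
  have w0: "w \<noteq> 0" using w by auto
  have "C_series (-w) $ n = (\<Sum>(x, y) | x\<^sup>2 + y\<^sup>2 = int n. (-1) powi x * (-w) powi y)"
    unfolding C_series_minus_root3[OF w] by (subst theta_mult_nth) auto
  also have "\<dots> = (\<Sum>(x, y) | x\<^sup>2 + y\<^sup>2 = int n. (-1) ^ n * w powi y)"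
  proof (intro sum.cong refl, clarify)
    fix x y :: int assume "x\<^sup>2 + y\<^sup>2 = int n"
    then have "even n \<longleftrightarrow> even (x + y)"
      by (metis even_add even_of_nat_iff square_parity)
    then show "(- 1) powi x * (- w) powi y = (- 1 :: complex) ^ n * w powi y"
      by (auto simp: minus_one_powi power_int_minus_left)
  qed
  also have "\<dots> = (-1) ^ n * (\<Sum>(x, y) | x\<^sup>2 + y\<^sup>2 = int n. w powi y)"
    by (simp add: sum_distrib_left case_prod_beta)
  finally have "C_at n (-w) = ((-1) ^ n * (-w) ^ n) * (\<Sum>(x, y) | x\<^sup>2 + y\<^sup>2 = int n. w powi y)"
    using C_at_eq_nth[OF n, of "-w"] w0 by simp
  also have "(-1) ^ n * (-w) ^ n = w ^ n" by (simp flip: power_mult_distrib)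
  also have "w ^ n = w ^ (n mod 3)" by (rule root3_power_mod[OF w])
  finally have *: "C_at n (-w) = w ^ (n mod 3) * (\<Sum>(x, y) | x\<^sup>2 + y\<^sup>2 = int n. w powi y)" .
  have "n mod 3 = 0 \<or> n mod 3 = 1 \<or> n mod 3 = 2" by linarith
  then show ?thesis unfolding * sum_root3_two_squares[OF w] by (elim disjE) simp_all
qed

lemma P_at_minus_root3:
  assumes w: "w\<^sup>2 + w + 1 = 0" and n: "n \<ge> 1"
  shows "P_at n (-w) = C_at n (-w) / w" "P_at n (-w) = C_at n (-w) * w ^ 2"
proof -
  have w0: "w \<noteq> 0" using w by auto
  have "(- w - 1)\<^sup>2 = (w\<^sup>2 + w + 1) + w" by (simp add: power2_eq_square algebra_simps)
  then have "P_at n (-w) * w = C_at n (-w)" using P_at_mult[OF n, of "-w"] w by simp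
  then show 1: "P_at n (-w) = C_at n (-w) / w" using w0 by (simp add: field_simps)
  have "inverse w = w\<^sup>2" using root3_cube[OF w]
    by (intro inverse_unique) (simp add: power3_eq_cube power2_eq_square mult.assoc)
  then show "P_at n (-w) = C_at n (-w) * w ^ 2" unfolding 1 by (simp add: divide_inverse)
qed

subsection \<open>The divisor sum of the character modulo 3\<close>

definition chi3 :: "nat \<Rightarrow> int" where
  "chi3 d = (if d mod 3 = 0 then 0 else if d mod 3 = 1 then 1 else -1)"

lemma chi3_mult: "chi3 (a * b) = chi3 a * chi3 b"
proof -
  have "a mod 3 = 0 \<or> a mod 3 = 1 \<or> a mod 3 = 2" "b mod 3 = 0 \<or> b mod 3 = 1 \<or> b mod 3 = 2" by linarith+
  then show ?thesis
    unfolding chi3_def mod_mult_eq[of a 3 b, symmetric] by (elim disjE) simp_all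
qed

lemma chi3_power: "chi3 (a ^ n) = chi3 a ^ n"
  by (induction n) (simp_all add: chi3_mult, simp add: chi3_def)

text \<open>For n > 0 this counts the ideals of norm n in the Eisenstein integers, one sixth of the
  representations of n by x^2 + x y + y^2.\<close>

definition chi3_sum :: "nat \<Rightarrow> int" where
  "chi3_sum n = (\<Sum>d | d dvd n. chi3 d)"

lemma chi3_sum_mult:
  assumes "coprime a b"
  shows "chi3_sum (a * b) = chi3_sum a * chi3_sum b"
proof -
  let ?f = "\<lambda>(x::nat, y). x * y"
  have inj: "inj_on ?f ({x. x dvd a} \<times> {y. y dvd b})"
  proof (rule inj_onI, clarify)
    fix x y x' y' assume *: "x dvd a" "y dvd b" "x' dvd a" "y' dvd b" "x * y = x' * y'"
    have cop: "coprime x y'" "coprime x' y"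
      using coprime_divisors[OF *(1) *(4) assms] coprime_divisors[OF *(3) *(2) assms] by auto
    have "x dvd x' * y'" "x' dvd x * y" "y dvd x' * y'" "y' dvd x * y"
      using *(5) by (metis dvd_triv_left dvd_triv_right)+
    then have "x dvd x'" "x' dvd x" "y dvd y'" "y' dvd y"
      using cop by (simp_all add: coprime_dvd_mult_left_iff coprime_dvd_mult_right_iff coprime_commute)
    then show "x = x' \<and> y = y'" by (simp add: dvd_antisym)
  qed
  have "?f ` ({x. x dvd a} \<times> {y. y dvd b}) = {d. d dvd a * b}"
  proof (intro equalityI subsetI)
    fix d assume "d \<in> {d. d dvd a * b}"
    then obtain x y where "d = x * y" "x dvd a" "y dvd b"
      using division_decomp by blast
    then show "d \<in> ?f ` ({x. x dvd a} \<times> {y. y dvd b})" by auto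
  qed (auto intro: mult_dvd_mono)
  then have "chi3_sum (a * b) = sum chi3 (?f ` ({x. x dvd a} \<times> {y. y dvd b}))"
    by (simp add: chi3_sum_def)
  also have "\<dots> = (\<Sum>(x, y)\<in>{x. x dvd a} \<times> {y. y dvd b}. chi3 x * chi3 y)"
    by (subst sum.reindex[OF inj]) (simp add: case_prod_beta chi3_mult)
  also have "\<dots> = chi3_sum a * chi3_sum b"
    by (simp add: chi3_sum_def sum_product sum.cartesian_product)
  finally show ?thesis .
qed

lemma chi3_sum_prime_power:
  assumes "prime p"
  shows "chi3_sum (p ^ e) = (\<Sum>i\<le>e. chi3 p ^ i)"
proof -
  have "{d. d dvd p ^ e} = (\<lambda>i. p ^ i) ` {..e}"
    using assms by (auto simp: divides_primepow_nat image_iff)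
  moreover have "inj_on (\<lambda>i. p ^ i) {..e}"
    using prime_gt_1_nat[OF assms] by (intro inj_onI) simp
  ultimately show ?thesis
    by (simp add: chi3_sum_def sum.reindex chi3_power)
qed

text \<open>Complementary divisors d and n/d have characters with product \<open>chi3 n\<close> =
  -1, so their contributions cancel.\<close>

lemma chi3_sum_eq_0:
  assumes "n mod 3 = 2"
  shows "chi3_sum n = 0"
proof -
  have n: "n > 0" using assms by (cases n) auto
  have "chi3_sum n = (\<Sum>d | d dvd n. - chi3 d)"
    unfolding chi3_sum_def
  proof (rule sum.reindex_bij_witness[of _ "\<lambda>d. n div d" "\<lambda>d. n div d"])
    fix d assume "d \<in> {d. d dvd n}"
    then have d: "d dvd n" by simp
    then obtain k where k: "n = d * k" by (rule dvdE)
    then have "d > 0" "k > 0" using n by auto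
    then have nd: "n div d = k" "n div k = d" using k by simp_all
    have "chi3 k * chi3 d = chi3 n" unfolding k by (simp add: chi3_mult)
    also have "\<dots> = -1" using assms by (simp add: chi3_def)
    finally show "- chi3 (n div d) = chi3 d"
      unfolding nd by (simp add: chi3_def split: if_splits)
    show "n div (n div d) = d" "n div (n div d) = d" using nd by simp_all
    show "n div d \<in> {d. d dvd n}" "n div d \<in> {d. d dvd n}" using nd k by simp_all
  qed
  then show ?thesis by (simp add: chi3_sum_def sum_negf)
qed

lemma sum_minus_one_power: "(\<Sum>i\<le>e. (-1) ^ i :: int) = (1 + (-1) ^ e) div 2"
  by (induction e) auto

text \<open>Both sides are multiplicative: 3 divides at most one of two coprime factors, so the
  factor -2 occurs at most once. Splitting off a full prime power reduces the claim to
  \<open>lambda_pp\<close>.\<close>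

lemma lambda_eq_chi3_sum:
  assumes "n > 0"
  shows "lambda n = (if 3 dvd n then -2 else 1) * chi3_sum n"
  using assms
proof (induction n rule: less_induct)
  case (less n)
  show ?case
  proof (cases "n = 1")
    case True
    have "{d. d dvd (1::nat)} = {1}" by auto
    then show ?thesis unfolding True by (simp add: lambda_1[simplified] chi3_sum_def chi3_def)
  next
    case False
    obtain p where p: "prime p" "p dvd n" using prime_factor_nat[OF False] by blast
    define e where "e = multiplicity p n"
    obtain m where m: "n = p ^ e * m" "\<not> p dvd m"
      using multiplicity_decompose'[of n p] less.prems p(1) unfolding e_def by (metis less_irrefl not_prime_unit)
    have e: "e > 0" using m p(2) by (cases e) auto
    have m0: "m > 0" using m(2) by (cases m) auto
    have "p ^ e > 1" by (rule one_less_power[OF prime_gt_1_nat[OF p(1)] e])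
    then have "m < n" using m(1) m0 by simp
    have cop: "coprime (p ^ e) m" using m(2) p(1) by (simp add: prime_imp_coprime)
    have pe: "lambda_pp p e = (if 3 dvd p ^ e then -2 else 1) * chi3_sum (p ^ e)"
    proof (cases "p = 3")
      case True
      \<comment> \<open>For p = 3 only the divisor 1 contributes, through 0^0 = 1.\<close>
      have "(\<Sum>i\<le>e. (0::int) ^ i) = 1" by (induction e) auto
      then show ?thesis
        using True e p(1) unfolding chi3_sum_prime_power[OF p(1)] by (simp add: lambda_pp_def chi3_def)
    next
      case False
      have "\<not> 3 dvd p" using False p(1) primes_dvd_imp_eq[of 3 p] by auto
      then have n3: "\<not> 3 dvd p ^ e" using prime_dvd_power[of 3 p e] by auto
      \<comment> \<open>\<open>lambda_pp\<close> tests residues modulo 6 and \<open>chi3\<close>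
        modulo 3. They could disagree only for p = 4 modulo 6, which no prime satisfies.\<close>
      have "even p \<Longrightarrow> p = 2" using p(1) primes_dvd_imp_eq[of 2 p] by auto
      then have "p mod 6 = 1 \<longleftrightarrow> p mod 3 = 1" by presburger
      then have "lambda_pp p e = (if p mod 3 = 1 then int e + 1 else (1 + (-1) ^ e) div 2)"
        using False by (simp only: lambda_pp_def if_False)
      moreover have "chi3 p = (if p mod 3 = 1 then 1 else -1)"
        using \<open>\<not> 3 dvd p\<close> by (simp add: chi3_def dvd_eq_mod_eq_0)
      ultimately show ?thesis
        unfolding chi3_sum_prime_power[OF p(1)]
        by (cases "p mod 3 = 1") (simp_all add: sum_minus_one_power n3)
    qed
    have "\<not> (3 dvd p ^ e \<and> 3 dvd m)"
      using cop by (metis coprime_common_divisor_nat numeral_eq_one_iff semiring_norm(86))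
    moreover have "3 dvd p ^ e * m \<longleftrightarrow> 3 dvd p ^ e \<or> 3 dvd m"
      by (rule prime_dvd_mult_nat) simp
    ultimately show ?thesis
      using pe less.IH[OF \<open>m < n\<close> m0] lambda_mult[OF cop] chi3_sum_mult[OF cop] lambda_prime_power[of p e] p(1) e
      unfolding m(1) by auto
  qed
qed

subsection \<open>The logarithmic derivative of the triple product\<close>

text \<open>The indices of the theta terms with exponent n(n-1)/2 equal to k; the set is closed
  under the reflection of n to 1 - n.\<close>

definition triangular_roots :: "nat \<Rightarrow> int set" where
  "triangular_roots k = {n. n * (n - 1) = 2 * int k}"

lemma double_triangular: "2 * (n * (n - 1) div 2) = n * (n - 1)" for n :: int
  by (rule dvd_mult_div_cancel) simp

text \<open>Ensures that for k < N the range from -N to N contains every index contributing to the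
  k-th coefficient.\<close>

lemma triangular_roots_bound:
  assumes "n \<in> triangular_roots k"
  shows "\<bar>n\<bar> \<le> int k + 1"
proof (rule ccontr)
  assume n: "\<not> \<bar>n\<bar> \<le> int k + 1"
  have eq: "n * (n - 1) = 2 * int k" using assms by (simp add: triangular_roots_def)
  show False
  proof (cases "n \<ge> 0")
    case True
    then have "2 * (int k + 1) \<le> n * (n - 1)" using n by (intro mult_mono) auto
    then show False using eq by (simp add: algebra_simps)
  next
    case False
    then have "2 * (int k + 2) \<le> (-n) * (1 - n)" using n by (intro mult_mono) auto
    then show False using eq by (simp add: algebra_simps)
  qed
qed

text \<open>The truncated triple product for x = -z, y = -t/z, q = t, with general term (-z)^n
  t^(n(n-1)/2). The signs place a zero at z = 1.\<close>

definition jacobi_prod :: "nat \<Rightarrow> complex \<Rightarrow> complex fps" where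
  "jacobi_prod N z = qfact fps_X N * (\<Prod>i<N. 1 - fps_const z * fps_X ^ i) *
     (\<Prod>i<N. 1 - fps_const (inverse z) * fps_X ^ Suc i)"

text \<open>The coefficient is already exact for finite N, with one N valid for all nonzero z. This
  is what permits differentiation in z before any limit.\<close>

lemma jacobi_prod_nth:
  assumes "k < N" "z \<noteq> 0"
  shows "jacobi_prod N z $ k = (\<Sum>n\<in>triangular_roots k. (-z) powi n)"
proof -
  define x where "x = fps_const (-z)"
  define y where "y = fps_const (inverse (-z)) * fps_X"
  have "fps_const (-z) * fps_const (inverse (-z)) = 1"
    unfolding fps_const_mult using assms(2) by simp
  then have q: "x * y = fps_X" by (simp only: x_def y_def mult.assoc[symmetric] mult_1_left)
  have c: "jtp_coeff x y n = fps_const ((-z) powi n) * fps_X ^ nat (n * (n - 1) div 2)" for n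
  proof -
    obtain a where a: "n * (n + 1) div 2 = a + n" "n * (n - 1) div 2 = a" "a \<ge> 0" "a + n \<ge> 0"
      by (rule triangular_step)
    have "(-z) powi n = (-z) powi (a + n) * (-z) powi (- a)"
      using assms(2) by (simp flip: power_int_add)
    also have "\<dots> = (-z) ^ nat (a + n) * inverse (-z) ^ nat a"
      using a(3,4) by (simp add: power_int_def power_inverse)
    finally show ?thesis unfolding jtp_coeff_def a(1,2) x_def y_def
      by (simp only: power_mult_distrib fps_const_power fps_const_mult mult.assoc[symmetric])
  qed
  have "fps_X ^ N dvd qfact fps_X N * (\<Prod>i<N. 1 + x * fps_X ^ i) * (\<Prod>i<N. 1 + y * fps_X ^ i) - (\<Sum>n=-int N..int N. jtp_coeff x y n)"
  proof (rule jacobi_triple_dvd[OF q])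
    fix n assume n: "\<bar>n\<bar> \<le> int N"
    obtain a where a: "n * (n + 1) div 2 = a + n" "n * (n - 1) div 2 = a" "a \<ge> 0" "a + n \<ge> 0"
      "(n - 1) * (n - 1 - 1) div 2 = a - n + 1" "a - n + 1 \<ge> 0"
      by (rule triangular_step)
    \<comment> \<open>The bound makes the total exponent a + (N - |n| + 1) at least N.\<close>
    have "a \<ge> \<bar>n\<bar> - 1"
    proof (cases "n \<ge> 0")
      case False
      have "(n + 1) * n \<ge> 0" using False by (intro mult_nonpos_nonpos) auto
      then have "n * (n + 1) div 2 \<ge> 0" by (simp add: mult.commute)
      then have "a + n \<ge> 0" using a(1) by simp
      have "n * (n - 1) = 2 * a" using double_triangular[of n] a(2) by simp
      moreover have "(n + 1) * n + 2 \<ge> 0" using \<open>(n + 1) * n \<ge> 0\<close> by simp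
      ultimately have "2 * a \<ge> - 2 * n - 2" by (simp add: algebra_simps)
      then show ?thesis using False by simp
    qed (use a in auto)
    then have "N \<le> nat a + Suc (N - nat \<bar>n\<bar>)" using n a(3) by linarith
    then have "fps_X ^ N dvd (fps_X ^ (nat a + Suc (N - nat \<bar>n\<bar>)) :: complex fps)"
      by (rule le_imp_power_dvd)
    then show "fps_X ^ N dvd jtp_coeff x y n * fps_X ^ Suc (N - nat \<bar>n\<bar>)"
      unfolding c a(2) mult.assoc power_add[symmetric] by (rule dvd_mult)
  qed
  moreover have "qfact fps_X N * (\<Prod>i<N. 1 + x * fps_X ^ i) * (\<Prod>i<N. 1 + y * fps_X ^ i) = jacobi_prod N z"
    unfolding jacobi_prod_def x_def y_def inverse_minus_eq fps_const_neg[symmetric]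
    by (simp only: mult_minus_left diff_conv_add_uminus mult.assoc power_Suc)
  ultimately obtain h where "jacobi_prod N z - (\<Sum>n=-int N..int N. jtp_coeff x y n) = fps_X ^ N * h"
    by (auto simp: dvd_def)
  then have "(jacobi_prod N z - (\<Sum>n=-int N..int N. jtp_coeff x y n)) $ k = 0"
    using assms(1) by (simp add: fps_X_power_mult_nth)
  then have "jacobi_prod N z $ k = (\<Sum>n=-int N..int N. jtp_coeff x y n $ k)"
    by (simp add: fps_sum_nth)
  also have "\<dots> = (\<Sum>n=-int N..int N. if n \<in> triangular_roots k then (-z) powi n else 0)"
  proof (intro sum.cong refl)
    fix n :: int
    obtain a where a: "n * (n + 1) div 2 = a + n" "n * (n - 1) div 2 = a" "a \<ge> 0" "a + n \<ge> 0"
      by (rule triangular_step)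
    have "n * (n - 1) = 2 * a" using double_triangular[of n] a(2) by simp
    then have "n \<in> triangular_roots k \<longleftrightarrow> k = nat a" using a(3) by (auto simp: triangular_roots_def)
    then show "jtp_coeff x y n $ k = (if n \<in> triangular_roots k then (-z) powi n else 0)"
      unfolding c a(2) fps_mult_left_const_nth fps_X_power_nth by simp
  qed
  also have "\<dots> = (\<Sum>n\<in>{n \<in> {-int N..int N}. n \<in> triangular_roots k}. (-z) powi n)"
    by (rule sum.inter_filter[symmetric]) simp
  also have "{n \<in> {-int N..int N}. n \<in> triangular_roots k} = triangular_roots k"
    using triangular_roots_bound assms(1) by fastforce
  finally show ?thesis .
qed

text \<open>\<open>F\<close> is \<open>z df/dz\<close>, taken coefficientwise, at the point \<open>z\<close>.\<close>

definition has_zderiv :: "(complex \<Rightarrow> complex fps) \<Rightarrow> complex fps \<Rightarrow> complex \<Rightarrow> bool" where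
  "has_zderiv f F z \<longleftrightarrow> (\<forall>k. ((\<lambda>x. f x $ k) has_field_derivative F $ k / z) (at z))"

lemma has_zderiv_mult:
  assumes "has_zderiv f F z" "has_zderiv g G z"
  shows "has_zderiv (\<lambda>x. f x * g x) (F * g z + f z * G) z"
  unfolding has_zderiv_def
proof
  fix k
  have "((\<lambda>x. \<Sum>i=0..k. f x $ i * g x $ (k - i)) has_field_derivative
     (\<Sum>i=0..k. f z $ i * (G $ (k - i) / z) + F $ i / z * g z $ (k - i))) (at z)"
    using assms unfolding has_zderiv_def by (intro DERIV_sum DERIV_mult') auto
  also have "(\<Sum>i=0..k. f z $ i * (G $ (k - i) / z) + F $ i / z * g z $ (k - i)) = (F * g z + f z * G) $ k / z"
    by (simp add: fps_mult_nth sum_divide_distrib sum.distrib add_divide_distrib)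
  finally show "((\<lambda>x. (f x * g x) $ k) has_field_derivative (F * g z + f z * G) $ k / z) (at z)"
    by (simp add: fps_mult_nth)
qed

lemma has_zderiv_const: "has_zderiv (\<lambda>_. c) 0 z"
  by (simp add: has_zderiv_def)

lemma has_zderiv_linear:
  assumes "z \<noteq> 0"
  shows "has_zderiv (\<lambda>x. 1 - fps_const x * fps_X ^ m) (- (fps_const z * fps_X ^ m)) z"
    "has_zderiv (\<lambda>x. 1 - fps_const (inverse x) * fps_X ^ m) (fps_const (inverse z) * fps_X ^ m) z"
  unfolding has_zderiv_def using assms
  by (auto intro!: derivative_eq_intros simp: fps_X_power_nth power2_eq_square field_simps)

text \<open>Here \<open>l i\<close> is the logarithmic derivative of \<open>g i\<close>; the
  hypothesis in multiplied form avoids dividing by a factor.\<close>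

lemma has_zderiv_prod:
  fixes N :: nat
  assumes "\<And>i. has_zderiv (g i) (g i z * l i) z"
  shows "has_zderiv (\<lambda>x. \<Prod>i<N. g i x) ((\<Prod>i<N. g i z) * (\<Sum>i<N. l i)) z"
proof (induction N)
  case 0
  show ?case using has_zderiv_const[of 1 z] by simp
next
  case (Suc N)
  have "has_zderiv (\<lambda>x. (\<Prod>i<N. g i x) * g N x) ((\<Prod>i<N. g i z) * (\<Sum>i<N. l i) * g N z + (\<Prod>i<N. g i z) * (g N z * l N)) z"
    by (rule has_zderiv_mult[OF Suc assms])
  then show ?case by (simp add: algebra_simps)
qed

text \<open>The expansion of z t^m / (1 - z t^m), which is minus the logarithmic derivative of 1 - z
  t^m.\<close>

definition geometric :: "nat \<Rightarrow> complex \<Rightarrow> complex fps" where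
  "geometric m z = Abs_fps (\<lambda>k. if 0 < k \<and> m dvd k then z ^ (k div m) else 0)"

lemma geometric_mult:
  assumes "m > 0"
  shows "(1 - fps_const z * fps_X ^ m) * geometric m z = fps_const z * fps_X ^ m"
proof (rule fps_ext)
  fix k
  have "((1 - fps_const z * fps_X ^ m) * geometric m z) $ k = geometric m z $ k - z * (if k < m then 0 else geometric m z $ (k - m))"
    by (simp add: left_diff_distrib mult.assoc fps_X_power_mult_nth)
  also have "\<dots> = (fps_const z * fps_X ^ m) $ k"
  proof (cases "m dvd k")
    case True
    then obtain r where k: "k = m * r" by blast
    consider "r = 0" | "r = 1" | r' where "r = Suc (Suc r')" by (metis One_nat_def not0_implies_Suc)
    then show ?thesis
    proof cases
      case 3
      then have "k - m = m * Suc r'" "k \<noteq> m" "\<not> k < m" "k > 0" using assms by (simp_all add: k)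
      then show ?thesis using assms 3 by (simp add: geometric_def fps_X_power_nth k)
    qed (use assms in \<open>auto simp: k geometric_def fps_X_power_nth\<close>)
  next
    case False
    then have "k \<noteq> m" "k < m \<or> \<not> m dvd (k - m)" by (auto simp: dvd_diff_nat) (metis dvd_diffD dvd_refl not_le)
    then show ?thesis using False by (auto simp: geometric_def fps_X_power_nth)
  qed
  finally show "((1 - fps_const z * fps_X ^ m) * geometric m z) $ k = (fps_const z * fps_X ^ m) $ k" .
qed

text \<open>The i-th series meets t^k exactly when i + 1 divides k, and then contributes the power
  of z given by the complementary divisor. Divisors are at most k, so N >= k terms suffice.\<close>

lemma sum_geometric_nth:
  assumes "k \<le> N"
  shows "(\<Sum>i<N. geometric (Suc i) z) $ k = (if k = 0 then 0 else \<Sum>d | d dvd k. z ^ d)"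
proof (cases "k = 0")
  case False
  have "(\<Sum>i<N. geometric (Suc i) z) $ k = (\<Sum>i<N. if Suc i dvd k then z ^ (k div Suc i) else 0)"
    using False by (simp add: fps_sum_nth geometric_def)
  also have "\<dots> = (\<Sum>i\<in>{i\<in>{..<N}. Suc i dvd k}. z ^ (k div Suc i))"
    by (rule sum.inter_filter[symmetric]) simp
  also have "\<dots> = (\<Sum>d | d dvd k. z ^ d)"
  proof (rule sum.reindex_bij_witness[of _ "\<lambda>d. k div d - 1" "\<lambda>i. k div Suc i"])
    fix i assume "i \<in> {i \<in> {..<N}. Suc i dvd k}"
    then obtain r where r: "k = Suc i * r" by (auto elim: dvdE)
    then have d: "k div Suc i = r" "r > 0" using False by (simp_all only: nonzero_mult_div_cancel_left) auto
    show "k div Suc i \<in> {d. d dvd k}" unfolding d using r by simp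
    have "k div r = Suc i" using r d(2) by simp
    then show "k div (k div Suc i) - 1 = i" unfolding d by simp
  next
    fix d assume "d \<in> {d. d dvd k}"
    then obtain r where r: "k = d * r" by (auto elim: dvdE)
    then have "d > 0" "r > 0" using False by auto
    then have d: "k div d = r" "k div r = d" "Suc (r - 1) = r" using r by simp_all
    show "k div Suc (k div d - 1) = d" unfolding d by simp
    have "r \<le> k" using r \<open>d > 0\<close> by simp
    then have "r - 1 < N" using assms \<open>r > 0\<close> by linarith
    then show "k div d - 1 \<in> {i \<in> {..<N}. Suc i dvd k}" unfolding d
      using \<open>r - 1 < N\<close> r d(3) by simp
  qed simp
  finally show ?thesis using False by simp
qed (simp add: fps_sum_nth geometric_def)

text \<open>The logarithmic derivative of the infinite product of (1 - z t^i)(1 - t^i / z) over i >=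
  1.\<close>

definition lambert :: "complex \<Rightarrow> complex fps" where
  "lambert z = Abs_fps (\<lambda>k. if k = 0 then 0 else \<Sum>d | d dvd k. inverse z ^ d - z ^ d)"

text \<open>The Jacobi product without its factor \<open>1 - z\<close>, which vanishes at \<open>z = 1\<close>.\<close>

definition jacobi_prod' :: "nat \<Rightarrow> complex \<Rightarrow> complex fps" where
  "jacobi_prod' N z = qfact fps_X (Suc N) * (\<Prod>i<N. 1 - fps_const z * fps_X ^ Suc i) *
     (\<Prod>i<Suc N. 1 - fps_const (inverse z) * fps_X ^ Suc i)"

lemma jacobi_prod_Suc: "jacobi_prod (Suc N) z = fps_const (1 - z) * jacobi_prod' N z"
proof -
  have "(\<Prod>i<Suc N. 1 - fps_const z * fps_X ^ i) = fps_const (1 - z) * (\<Prod>i<N. 1 - fps_const z * fps_X ^ Suc i)"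
    by (subst prod.lessThan_Suc_shift) (simp flip: fps_const_sub)
  then show ?thesis unfolding jacobi_prod_def jacobi_prod'_def by (simp only: mult_ac)
qed

text \<open>The k-th coefficient of the product is differentiated twice, once as a finite theta sum
  and once by the product rule. Keeping the factor 1 - z apart makes the formula valid at z = 1,
  where only -H remains.\<close>

lemma triangular_roots_zderiv:
  assumes z: "z \<noteq> 0" and H: "(\<lambda>N. jacobi_prod' N z) \<longlonglongrightarrow> H"
  shows "(\<Sum>n\<in>triangular_roots k. (-z) powi n) = (fps_const (1 - z) * H) $ k"
    "(\<Sum>n\<in>triangular_roots k. of_int n * (-z) powi n) =
       (- (fps_const z * H) + fps_const (1 - z) * (H * lambert z)) $ k"
proof -
  define L where "L N = - (\<Sum>i<N. geometric (Suc i) z) + (\<Sum>i<Suc N. geometric (Suc i) (inverse z))" for N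
  have L: "L \<longlonglongrightarrow> lambert z"
  proof (rule tendsto_fpsI)
    fix k show "\<forall>\<^sub>F N in sequentially. L N $ k = lambert z $ k"
      using eventually_ge_at_top[of k]
    proof eventually_elim
      case (elim N)
      then show ?case unfolding L_def
        using sum_geometric_nth[of k N z] sum_geometric_nth[of k "Suc N" "inverse z"]
        by (simp add: lambert_def sum_subtractf del: sum.lessThan_Suc)
    qed
  qed
  have const: "(\<lambda>N. c) \<longlonglongrightarrow> c" for c :: "complex fps" by simp
  have lim1: "(\<lambda>N. fps_const (1 - z) * jacobi_prod' N z) \<longlonglongrightarrow> fps_const (1 - z) * H"
    by (intro tendsto_mult_fps const H)
  have lim2: "(\<lambda>N. fps_const (1 - z) * (jacobi_prod' N z * L N)) \<longlonglongrightarrow> fps_const (1 - z) * (H * lambert z)"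
    by (intro tendsto_mult_fps const H L)
  have lim3: "(\<lambda>N. fps_const z * jacobi_prod' N z) \<longlonglongrightarrow> fps_const z * H"
    by (intro tendsto_mult_fps const H)
  have "\<forall>\<^sub>F N in sequentially. (fps_const (1 - z) * jacobi_prod' N z) $ k = (fps_const (1 - z) * H) $ k"
       "\<forall>\<^sub>F N in sequentially. (fps_const (1 - z) * (jacobi_prod' N z * L N)) $ k = (fps_const (1 - z) * (H * lambert z)) $ k"
       "\<forall>\<^sub>F N in sequentially. (fps_const z * jacobi_prod' N z) $ k = (fps_const z * H) $ k"
    using lim1 lim2 lim3 unfolding tendsto_fps_iff by blast+
  \<comment> \<open>One N is fixed at which all the k-th coefficients have reached their limits; no
    limit is interchanged with a derivative.\<close>
  then have "\<forall>\<^sub>F N in sequentially. N > k \<and> (fps_const (1 - z) * jacobi_prod' N z) $ k = (fps_const (1 - z) * H) $ k \<and>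
     (fps_const (1 - z) * (jacobi_prod' N z * L N)) $ k = (fps_const (1 - z) * (H * lambert z)) $ k \<and>
     (fps_const z * jacobi_prod' N z) $ k = (fps_const z * H) $ k"
    using eventually_gt_at_top[of k] by eventually_elim blast
  from eventually_happens'[OF sequentially_bot this] obtain N where N: "N > k" "(fps_const (1 - z) * jacobi_prod' N z) $ k = (fps_const (1 - z) * H) $ k"
     "(fps_const (1 - z) * (jacobi_prod' N z * L N)) $ k = (fps_const (1 - z) * (H * lambert z)) $ k"
     "(fps_const z * jacobi_prod' N z) $ k = (fps_const z * H) $ k"
    by blast
  have nth: "(fps_const (1 - x) * jacobi_prod' N x) $ k = (\<Sum>n\<in>triangular_roots k. (-x) powi n)" if "x \<noteq> 0" for x
    using jacobi_prod_nth[of k "Suc N" x] N(1) that unfolding jacobi_prod_Suc by simp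
  show "(\<Sum>n\<in>triangular_roots k. (-z) powi n) = (fps_const (1 - z) * H) $ k"
    using nth[OF z] N(2) by simp
  have g1: "has_zderiv (\<lambda>x. 1 - fps_const x * fps_X ^ Suc i) ((1 - fps_const z * fps_X ^ Suc i) * (- geometric (Suc i) z)) z" for i
    unfolding mult_minus_right geometric_mult[OF zero_less_Suc] by (rule has_zderiv_linear(1)[OF z])
  have g2: "has_zderiv (\<lambda>x. 1 - fps_const (inverse x) * fps_X ^ Suc i) ((1 - fps_const (inverse z) * fps_X ^ Suc i) * geometric (Suc i) (inverse z)) z" for i
    unfolding mult_minus_right geometric_mult[OF zero_less_Suc] by (rule has_zderiv_linear(2)[OF z])
  define q :: "complex fps" where "q = qfact fps_X (Suc N)"
  define P where "P x = (\<Prod>i<N. 1 - fps_const x * fps_X ^ Suc i)" for x :: complex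
  define Q where "Q x = (\<Prod>i<Suc N. 1 - fps_const (inverse x) * fps_X ^ Suc i)" for x :: complex
  have h: "jacobi_prod' N x = q * P x * Q x" for x by (simp only: jacobi_prod'_def q_def P_def Q_def)
  have "has_zderiv P (P z * (\<Sum>i<N. - geometric (Suc i) z)) z"
    "has_zderiv Q (Q z * (\<Sum>i<Suc N. geometric (Suc i) (inverse z))) z"
    unfolding P_def Q_def by (rule has_zderiv_prod[OF g1] has_zderiv_prod[OF g2])+
  then have "has_zderiv (\<lambda>x. q * P x * Q x) ((0 * P z + q * (P z * (\<Sum>i<N. - geometric (Suc i) z))) * Q z +
      (q * P z) * (Q z * (\<Sum>i<Suc N. geometric (Suc i) (inverse z)))) z"
    by (intro has_zderiv_mult has_zderiv_const)
  also have "(0 * P z + q * (P z * (\<Sum>i<N. - geometric (Suc i) z))) * Q z +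
      (q * P z) * (Q z * (\<Sum>i<Suc N. geometric (Suc i) (inverse z))) = jacobi_prod' N z * L N"
    unfolding h L_def sum_negf by (simp add: algebra_simps del: sum.lessThan_Suc)
  finally have "has_zderiv (\<lambda>x. jacobi_prod' N x) (jacobi_prod' N z * L N) z" unfolding h .
  \<comment> \<open>The exponent 0 in the linear rule gives the derivative of 1 - x itself.\<close>
  moreover have "has_zderiv (\<lambda>x. fps_const (1 - x)) (- fps_const z) z"
    using has_zderiv_linear(1)[OF z, of 0] by (simp flip: fps_const_sub)
  ultimately have "has_zderiv (\<lambda>x. fps_const (1 - x) * jacobi_prod' N x) (- fps_const z * jacobi_prod' N z + fps_const (1 - z) * (jacobi_prod' N z * L N)) z"
    by (intro has_zderiv_mult)
  then have "((\<lambda>x. (fps_const (1 - x) * jacobi_prod' N x) $ k) has_field_derivative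
     (- fps_const z * jacobi_prod' N z + fps_const (1 - z) * (jacobi_prod' N z * L N)) $ k / z) (at z)"
    by (simp only: has_zderiv_def)
  moreover have "(- fps_const z * jacobi_prod' N z + fps_const (1 - z) * (jacobi_prod' N z * L N)) $ k =
     (- (fps_const z * H) + fps_const (1 - z) * (H * lambert z)) $ k"
    unfolding fps_add_nth mult_minus_left fps_neg_nth N(3) N(4) ..
  ultimately have 1: "((\<lambda>x. (fps_const (1 - x) * jacobi_prod' N x) $ k) has_field_derivative
     (- (fps_const z * H) + fps_const (1 - z) * (H * lambert z)) $ k / z) (at z)"
    by (simp only:)
  have "((\<lambda>x. \<Sum>n\<in>triangular_roots k. (-x) powi n) has_field_derivative
     (- (fps_const z * H) + fps_const (1 - z) * (H * lambert z)) $ k / z) (at z)"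
    \<comment> \<open>The theta expansion is known at all nonzero x, an open set containing
      z.\<close>
    by (rule has_field_derivative_transform_within_open[OF 1, of "- {0}"]) (use z nth in auto)
  moreover have "((\<lambda>x. \<Sum>n\<in>triangular_roots k. (-x) powi n) has_field_derivative
     (\<Sum>n\<in>triangular_roots k. of_int n * (-z) powi n / z)) (at z)"
  proof (intro DERIV_sum)
    fix n
    have "((\<lambda>x. (-x) powi n) has_field_derivative of_int n * (-z) powi (n - 1) * (-1)) (at z)"
      using z by (auto intro!: derivative_eq_intros)
    also have "of_int n * (-z) powi (n - 1) * (-1) = of_int n * (-z) powi n / z"
      using z by (simp add: power_int_diff)
    finally show "((\<lambda>x. (-x) powi n) has_field_derivative of_int n * (-z) powi n / z) (at z)" .
  qed
  ultimately have "(- (fps_const z * H) + fps_const (1 - z) * (H * lambert z)) $ k / z = (\<Sum>n\<in>triangular_roots k. of_int n * (-z) powi n / z)"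
    by (rule DERIV_unique)
  then show "(\<Sum>n\<in>triangular_roots k. of_int n * (-z) powi n) =
       (- (fps_const z * H) + fps_const (1 - z) * (H * lambert z)) $ k"
    using z by (simp add: sum_divide_distrib[symmetric])
qed

lemma tendsto_jacobi_prod'_1: "(\<lambda>N. jacobi_prod' N 1) \<longlonglongrightarrow> eulerE 1 ^ 3"
proof -
  have E: "(\<lambda>N. \<Prod>i<N. 1 - fps_X ^ (1 * Suc i)) \<longlonglongrightarrow> eulerE 1"
    unfolding eulerE_def by (intro tendsto_fps_prodinf euler_converges) simp
  have "(\<lambda>N. (\<Prod>i<Suc N. 1 - fps_X ^ (1 * Suc i)) * (\<Prod>i<N. 1 - fps_X ^ (1 * Suc i)) * (\<Prod>i<Suc N. 1 - fps_X ^ (1 * Suc i)))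
     \<longlonglongrightarrow> eulerE 1 * eulerE 1 * eulerE 1"
    by (intro tendsto_mult_fps E LIMSEQ_Suc[OF E])
  then show ?thesis unfolding jacobi_prod'_def qfact_def
    by (simp only: inverse_1 fps_const_1_eq_1 mult_1_left power3_eq_cube)
qed

text \<open>The factors belonging to w, 1/w and 1 combine to 1 - t^(3i). Two of the three products
  are one factor longer, and these two leftover factors tend to 1.\<close>

lemma tendsto_jacobi_prod'_root3:
  assumes w: "w\<^sup>2 + w + 1 = 0"
  shows "(\<lambda>N. jacobi_prod' N w) \<longlonglongrightarrow> eulerE 3"
proof -
  let ?t = "\<lambda>N. 1 - fps_const (inverse w) * fps_X ^ Suc N"
  let ?s = "\<lambda>N. 1 - fps_X ^ Suc N :: complex fps"
  have "(\<lambda>N. (\<Prod>i<N. 1 - fps_X ^ (3 * Suc i)) * (?s N * ?t N)) \<longlonglongrightarrow> eulerE 3 * (1 * 1)"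
  proof (intro tendsto_mult_fps)
    show "(\<lambda>N. \<Prod>i<N. 1 - fps_X ^ (3 * Suc i)) \<longlonglongrightarrow> eulerE 3"
      unfolding eulerE_def by (intro tendsto_fps_prodinf euler_converges) simp
    show "?s \<longlonglongrightarrow> 1" "?t \<longlonglongrightarrow> 1"
    proof -
      have "(\<lambda>N. 1 - fps_const c * fps_X ^ Suc N) \<longlonglongrightarrow> 1" for c :: complex
      proof (rule tendsto_fpsI)
        fix k show "\<forall>\<^sub>F N in sequentially. (1 - fps_const c * fps_X ^ Suc N) $ k = 1 $ k"
          using eventually_ge_at_top[of k]
          by eventually_elim (simp add: fps_X_power_nth del: power_Suc)
      qed
      from this[of 1] this[of "inverse w"] show "?s \<longlonglongrightarrow> 1" "?t \<longlonglongrightarrow> 1"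
        by (simp_all only: fps_const_1_eq_1 mult_1_left)
    qed
  qed
  moreover have "jacobi_prod' N w = (\<Prod>i<N. 1 - fps_X ^ (3 * Suc i)) * (?s N * ?t N)" for N
  proof -
    have "jacobi_prod' N w = (\<Prod>i<N. (1 - fps_const w * fps_X ^ Suc i) * ?t i * ?s i) * (?s N * ?t N)"
      unfolding jacobi_prod'_def qfact_def prod.distrib prod.lessThan_Suc by (simp only: mult_ac)
    then show ?thesis unfolding root3_factorization[OF w] power_mult[symmetric] by (simp only: mult.commute)
  qed
  ultimately show ?thesis by simp
qed

subsection \<open>The value at \<open>j\<close>\<close>

text \<open>As a function of d modulo 3, w^(-d) - w^d is odd, hence a multiple of the character; w^2
  - w is its value at d = 1.\<close>

lemma lambert_root3:
  assumes w: "w\<^sup>2 + w + 1 = 0"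
  shows "lambert w = fps_const (w\<^sup>2 - w) * Abs_fps (\<lambda>k. if k = 0 then 0 else of_int (chi3_sum k))"
proof -
  have inv: "inverse w = w\<^sup>2" using root3_cube[OF w]
    by (intro inverse_unique) (simp add: power3_eq_cube power2_eq_square mult.assoc)
  have chi: "inverse w ^ d - w ^ d = (w\<^sup>2 - w) * of_int (chi3 d)" for d
  proof -
    note pm = root3_power_mod[OF w]
    have "inverse w ^ d = w ^ (2 * d mod 3)" unfolding inv power_mult[symmetric] by (rule pm)
    moreover have "d mod 3 = 0 \<and> 2 * d mod 3 = 0 \<or> d mod 3 = 1 \<and> 2 * d mod 3 = 2 \<or> d mod 3 = 2 \<and> 2 * d mod 3 = 1"
      by presburger
    ultimately show ?thesis unfolding pm[of d] chi3_def by (elim disjE conjE) simp_all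
  qed
  show ?thesis
    by (rule fps_ext) (simp add: lambert_def chi chi3_sum_def sum_distrib_left)
qed

text \<open>
  Differentiating the triple product at \<open>z = 1\<close> gives \<open>\<eta>(\<tau>)\<^sup>3\<close>, and at \<open>z = w\<close> it gives
  \<open>\<eta>(3\<tau>)\<close> times a Lambert series. Both theta series are combinations of the same three sums over
  the residue classes of \<open>n\<close> modulo 3. The reflection \<open>n \<mapsto> 1 - n\<close> exchanges the classes 0 and 1, and
  the exponent \<open>k = n(n-1)/2\<close> modulo 3 separates them from the class 2, while \<open>\<eta>(3\<tau>)\<close> only
  involves exponents divisible by 3.
\<close>

lemma sum_triangular_roots_reflect:
  "(\<Sum>n\<in>triangular_roots k. f n) = (\<Sum>n\<in>triangular_roots k. f (1 - n))"
  by (rule sum.reindex_bij_witness[of _ "\<lambda>n. 1 - n" "\<lambda>n. 1 - n"])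
     (auto simp: triangular_roots_def algebra_simps)

lemma triangular_roots_mod_3:
  assumes "n \<in> triangular_roots k"
  shows "n mod 3 = 2 \<longleftrightarrow> k mod 3 = 1" "n mod 3 \<noteq> 2 \<longleftrightarrow> k mod 3 = 0"
proof -
  have "n * (n - 1) = 2 * int k" using assms by (simp add: triangular_roots_def)
  then have *: "(n mod 3) * ((n - 1) mod 3) mod 3 = (2 * int (k mod 3)) mod 3"
    by (simp only: mod_mult_left_eq zmod_int mod_mult_right_eq of_nat_numeral)
  have "n mod 3 = 0 \<and> (n - 1) mod 3 = 2 \<or> n mod 3 = 1 \<and> (n - 1) mod 3 = 0 \<or> n mod 3 = 2 \<and> (n - 1) mod 3 = 1"
    by presburger
  moreover have "k mod 3 = 0 \<or> k mod 3 = 1 \<or> k mod 3 = 2" by linarith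
  ultimately show "n mod 3 = 2 \<longleftrightarrow> k mod 3 = 1" "n mod 3 \<noteq> 2 \<longleftrightarrow> k mod 3 = 0"
    using * by (elim disjE conjE; simp)+
qed

lemma minus_one_powi_reflect: "(-1) powi (1 - n) = - ((-1) powi n :: complex)"
  by (simp add: minus_one_powi)

lemma eulerE_nth_dissection:
  assumes w: "w\<^sup>2 + w + 1 = (0 :: complex)"
  defines "Y \<equiv> eulerE 3 * Abs_fps (\<lambda>k. if k = 0 then 0 else of_int (chi3_sum k))"
  shows "k mod 3 \<noteq> 0 \<Longrightarrow> eulerE 3 $ k = 0"
    and "(eulerE 1 ^ 3) $ k = (if k mod 3 = 0 then eulerE 3 $ k + 6 * Y $ k else if k mod 3 = 1 then - 3 * Y $ k else 0)"
proof -
  define e where "e = eulerE 3 $ k"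
  define y where "y = Y $ k"
  \<comment> \<open>\<open>R\<close> and \<open>S\<close> split the theta sum and its z-derivative
    by the class of n. Replacing w by 1 recombines the same three class sums \<open>S\<close> with
    weights 1.\<close>
  define R where "R r = (\<Sum>n\<in>triangular_roots k. if n mod 3 = r then (-1) powi n else 0 :: complex)" for r :: int
  define S where "S r = (\<Sum>n\<in>triangular_roots k. if n mod 3 = r then of_int n * (-1) powi n else 0 :: complex)" for r :: int
  have split: "(\<Sum>n\<in>triangular_roots k. g n * z powi n) =
     (\<Sum>n\<in>triangular_roots k. if n mod 3 = 0 then g n else 0) + z * (\<Sum>n\<in>triangular_roots k. if n mod 3 = 1 then g n else 0)
      + z\<^sup>2 * (\<Sum>n\<in>triangular_roots k. if n mod 3 = 2 then g n else 0)"
    if "\<And>n. z powi n = z powi (n mod 3)" for z :: complex and g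
  proof -
    have "g n * z powi n = (if n mod 3 = 0 then g n else 0) + z * (if n mod 3 = 1 then g n else 0) + z\<^sup>2 * (if n mod 3 = 2 then g n else 0)" for n
    proof -
      have "n mod 3 = 0 \<or> n mod 3 = 1 \<or> n mod 3 = 2" by presburger
      then show ?thesis unfolding that[of n] by (elim disjE) (simp_all add: power_int_def)
    qed
    then show ?thesis by (simp only: sum.distrib sum_distrib_left)
  qed
  have pw: "(-w) powi n = (-1) powi n * w powi n" for n
    using power_int_mult_distrib[of "-1" w n] by simp
  have F1: "(\<Sum>n\<in>triangular_roots k. (-w) powi n) = R 0 + w * R 1 + w\<^sup>2 * R 2"
    unfolding pw R_def by (rule split) (rule root3_powi_mod[OF w])
  have F2: "(\<Sum>n\<in>triangular_roots k. of_int n * (-w) powi n) = S 0 + w * S 1 + w\<^sup>2 * S 2"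
    unfolding pw S_def mult.assoc[symmetric] by (rule split) (rule root3_powi_mod[OF w])
  have F3: "(\<Sum>n\<in>triangular_roots k. of_int n * (-1) powi n) = S 0 + S 1 + S 2"
    using split[of 1 "\<lambda>n. of_int n * (-1) powi n"] unfolding S_def by simp
  have res: "(1 - n) mod 3 = 1 \<longleftrightarrow> n mod 3 = 0" "(1 - n) mod 3 = 2 \<longleftrightarrow> n mod 3 = 2" for n :: int
    by presburger+
  have "R 1 = - R 0"
    unfolding R_def by (subst sum_triangular_roots_reflect) (simp add: res minus_one_powi_reflect sum_negf[symmetric] if_distrib cong: if_cong)
  have "R 2 = - R 2"
    unfolding R_def by (subst sum_triangular_roots_reflect) (simp add: res minus_one_powi_reflect sum_negf[symmetric] if_distrib cong: if_cong)
  then have "R 2 = 0" by simp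
  \<comment> \<open>The reflection turns the weight n into 1 - n and reverses the sign, so (1 -
    n)(-1) = n - 1 is summed over class 0.\<close>
  have S1: "S 1 = S 0 - R 0"
    unfolding S_def R_def sum_subtractf[symmetric]
    by (subst sum_triangular_roots_reflect, intro sum.cong refl) (simp add: res minus_one_powi_reflect algebra_simps)
  have w1: "w \<noteq> 1" using w by auto
  have w0: "w \<noteq> 0" using w by auto
  have "(1 - w) * R 0 = R 0 + w * R 1 + w\<^sup>2 * R 2"
    using \<open>R 1 = - R 0\<close> \<open>R 2 = 0\<close> by (simp add: algebra_simps)
  also have "\<dots> = (1 - w) * e"
    using triangular_roots_zderiv(1)[OF w0 tendsto_jacobi_prod'_root3[OF w], of k] unfolding F1 by (simp add: e_def)
  finally have R0: "R 0 = e" using w1 by simp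
  have "eulerE 3 * lambert w = fps_const (w\<^sup>2 - w) * Y"
    unfolding lambert_root3[OF w] Y_def by (simp only: mult_ac)
  then have A: "S 0 + w * S 1 + w\<^sup>2 * S 2 = - (w * e) + (1 - w) * ((w\<^sup>2 - w) * y)"
    using triangular_roots_zderiv(2)[OF w0 tendsto_jacobi_prod'_root3[OF w], of k] unfolding F2 by (simp add: e_def y_def)
  have "(1 + w) = - w\<^sup>2" using w by (simp add: eq_neg_iff_add_eq_0 add_ac)
  then have B: "S 0 + w * S 1 + w\<^sup>2 * S 2 = - w\<^sup>2 * S 0 - w * e + w\<^sup>2 * S 2"
  proof -
    assume w2: "1 + w = - w\<^sup>2"
    have "S 0 + w * S 1 + w\<^sup>2 * S 2 = (1 + w) * S 0 - w * e + w\<^sup>2 * S 2"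
      unfolding S1 R0 by (simp add: algebra_simps)
    then show ?thesis unfolding w2 .
  qed
  \<comment> \<open>This produces the constant 3. Together with 1 + w = -w^2 the relation at w
    acquires a common factor w^2 and becomes S 2 - S 0 = 3y.\<close>
  have C: "(1 - w) * ((w\<^sup>2 - w) * y) = 3 * w\<^sup>2 * y"
  proof -
    have "(1 - w) * (w\<^sup>2 - w) = 3 * w\<^sup>2 - (w ^ 3 - 1) - (w\<^sup>2 + w + 1)"
      by (simp add: algebra_simps power2_eq_square power3_eq_cube)
    then have "(1 - w) * (w\<^sup>2 - w) = 3 * w\<^sup>2" using w root3_cube[OF w] by simp
    then show ?thesis by (simp only: mult.assoc[symmetric])
  qed
  have "- w\<^sup>2 * S 0 - w * e + w\<^sup>2 * S 2 = - (w * e) + 3 * w\<^sup>2 * y"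
    unfolding B[symmetric] A C ..
  then have "w\<^sup>2 * (S 2 - S 0) = w\<^sup>2 * (3 * y)"
    by (simp add: algebra_simps)
  then have S2: "S 2 - S 0 = 3 * y" using w0 by simp
  have lim1: "(\<lambda>N. jacobi_prod' N 1) \<longlonglongrightarrow> eulerE 1 ^ 3" by (rule tendsto_jacobi_prod'_1)
  \<comment> \<open>At z = 1 the factor 1 - z removes the Lambert term.\<close>
  have E1: "(eulerE 1 ^ 3) $ k = - (S 0 + S 1 + S 2)"
    using triangular_roots_zderiv(2)[OF _ lim1, of k] F3 by simp
  have n2: "R 0 = 0" "S 0 = 0" if "k mod 3 \<noteq> 0"
  proof -
    have "n mod 3 \<noteq> 0" if "n \<in> triangular_roots k" for n
      using triangular_roots_mod_3(2)[OF that] \<open>k mod 3 \<noteq> 0\<close> by auto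
    then show "R 0 = 0" "S 0 = 0"
      unfolding R_def S_def by (intro sum.neutral ballI; simp)+
  qed
  have n1: "S 2 = 0" if "k mod 3 \<noteq> 1"
  proof -
    have "n mod 3 \<noteq> 2" if "n \<in> triangular_roots k" for n
      using triangular_roots_mod_3(1)[OF that] \<open>k mod 3 \<noteq> 1\<close> by auto
    then show "S 2 = 0"
      unfolding S_def by (intro sum.neutral ballI) simp
  qed
  show "k mod 3 \<noteq> 0 \<Longrightarrow> eulerE 3 $ k = 0" using n2 R0 by (simp add: e_def)
  \<comment> \<open>In residue 0, S 2 = 0 and S 0 = -3y; in residue 1, R 0 = S 0 = 0 and S 2 = 3y;
    in residue 2 all class sums are empty.\<close>
  have "k mod 3 = 0 \<or> k mod 3 = 1 \<or> k mod 3 = 2" by linarith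
  then show "(eulerE 1 ^ 3) $ k = (if k mod 3 = 0 then eulerE 3 $ k + 6 * Y $ k else if k mod 3 = 1 then - 3 * Y $ k else 0)"
    unfolding E1 S1 e_def[symmetric] y_def[symmetric]
  proof (elim disjE)
    assume "k mod 3 = 0"
    moreover from this have "- S 0 = 3 * y" using S2 n1 by simp
    then have "S 0 = - (3 * y)" by (metis minus_minus)
    ultimately show "- (S 0 + (S 0 - R 0) + S 2) = (if k mod 3 = 0 then e + 6 * y else if k mod 3 = 1 then - 3 * y else 0)"
      using n1 R0 by simp
  next
    assume "k mod 3 = 1"
    then show "- (S 0 + (S 0 - R 0) + S 2) = (if k mod 3 = 0 then e + 6 * y else if k mod 3 = 1 then - 3 * y else 0)"
      using n2 S2 by simp
  next
    assume "k mod 3 = 2"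
    then show "- (S 0 + (S 0 - R 0) + S 2) = (if k mod 3 = 0 then e + 6 * y else if k mod 3 = 1 then - 3 * y else 0)"
      using n1 n2 by simp
  qed
qed

text \<open>For s = -1 the denominator is (1 - t^(3i)) / (1 - t^i), so the series is E(1)^3 / E(3).
  It remains to recognise the dissection of E(1)^3 as a product with E(3).\<close>

lemma C_series_root3:
  assumes w: "w\<^sup>2 + w + 1 = 0"
  shows "C_series w = Abs_fps (\<lambda>k. if k = 0 then 1 else if k mod 3 = 0 then 6 * of_int (chi3_sum k)
     else if k mod 3 = 1 then - 3 * of_int (chi3_sum k) else 0)" (is "_ = ?V")
proof -
  define X :: "complex fps" where "X = Abs_fps (\<lambda>k. if k = 0 then 0 else of_int (chi3_sum k))"
  note w0 = root3_nonzero[OF w] and inv = root3_inverse[OF w]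
  define D where "D = fps_prodinf (\<lambda>i. C_den (-1::complex) (Suc i))"
  have D: "D * eulerE 1 = eulerE 3"
    unfolding D_def eulerE_def
  proof (rule fps_prodinf_mult)
    have "(1 + x + x ^ 2) * (1 - x) = 1 - x ^ 3" for x :: "complex fps"
      by (simp add: power2_eq_square power3_eq_cube algebra_simps)
    then have "(1 + fps_X ^ k + (fps_X ^ k)\<^sup>2) * (1 - fps_X ^ k) = (1 - (fps_X ^ k) ^ 3 :: complex fps)" for k
      by blast
    moreover have "C_den (-1) k = (1 + fps_X ^ k + fps_X ^ (2 * k) :: complex fps)" for k
      unfolding C_den_def by (simp flip: fps_const_neg)
    ultimately show "C_den (-1) (Suc i) * (1 - fps_X ^ (1 * Suc i)) = (1 - fps_X ^ (3 * Suc i) :: complex fps)" for i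
      by (simp only: mult_1_left power_mult[symmetric] mult.commute mult_1_right)
  qed (use C_den_converges euler_converges(1)[of 1] euler_converges(1)[of 3] in auto)
  have "w + inverse w = -1" using inv by simp
  then have "C_series w * D = eulerE 1 ^ 2"
    using C_series_mult_den[OF w0] by (simp add: D_def)
  have "eulerE 3 * C_series w = (C_series w * D) * eulerE 1"
    unfolding D[symmetric] by (simp only: mult_ac)
  also have "\<dots> = eulerE 1 ^ 3"
    unfolding \<open>C_series w * D = eulerE 1 ^ 2\<close> power3_eq_cube power2_eq_square ..
  also have "\<dots> = eulerE 3 * ?V"
  proof (rule fps_ext)
    fix k
    \<comment> \<open>The weight is chosen by the residue of k instead of k - i. This is harmless
      because \<open>eulerE 3 $ i\<close> vanishes unless 3 divides i.\<close>
    define T where "T i = (if k mod 3 = 0 then (if i = k then 1 else 0) + 6 * X $ (k - i)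
         else if k mod 3 = 1 then - 3 * X $ (k - i) else 0)" for i
    have "(eulerE 3 * ?V) $ k = (\<Sum>i=0..k. eulerE 3 $ i * T i)"
      unfolding fps_mult_nth
    proof (intro sum.cong refl)
      fix i assume i: "i \<in> {0..k}"
      show "eulerE 3 $ i * ?V $ (k - i) = eulerE 3 $ i * T i"
      proof (cases "i mod 3 = 0")
        case True
        then obtain q where q: "i = 3 * q" by auto
        obtain r where r: "k = i + r" using i le_Suc_ex[of i k] by auto
        have "(3 * q + r) mod 3 = r mod 3" by simp
        then have kr: "k mod 3 = r mod 3" "k - i = r" "i = k \<longleftrightarrow> r = 0" unfolding r q by simp_all
        show ?thesis unfolding T_def kr X_def fps_nth_Abs_fps by (cases "r = 0") simp_all
      next
        case False
        then show ?thesis using eulerE_nth_dissection(1)[OF w] by simp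
      qed
    qed
    also have "\<dots> = (if k mod 3 = 0 then (\<Sum>i=0..k. eulerE 3 $ i * ((if i = k then 1 else 0) + 6 * X $ (k - i)))
         else if k mod 3 = 1 then (\<Sum>i=0..k. eulerE 3 $ i * (- 3 * X $ (k - i))) else 0)"
      by (simp add: T_def)
    finally have *: "(eulerE 3 * ?V) $ k = (if k mod 3 = 0 then (\<Sum>i=0..k. eulerE 3 $ i * ((if i = k then 1 else 0) + 6 * X $ (k - i)))
         else if k mod 3 = 1 then (\<Sum>i=0..k. eulerE 3 $ i * (- 3 * X $ (k - i))) else 0)" .
    have Y: "(\<Sum>i=0..k. eulerE 3 $ i * (c * X $ (k - i))) = c * (eulerE 3 * X) $ k" for c
      unfolding fps_mult_nth sum_distrib_left by (simp only: mult.left_commute)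
    have "(\<Sum>i=0..k. eulerE 3 $ i * (if i = k then 1 else 0)) = eulerE 3 $ k"
    proof -
      have "(\<Sum>i=0..k. eulerE 3 $ i * (if i = k then 1 else 0)) = (\<Sum>i=0..k. if i = k then eulerE 3 $ i else 0)"
        by (intro sum.cong) auto
      then show ?thesis by simp
    qed
    then have "(\<Sum>i=0..k. eulerE 3 $ i * ((if i = k then 1 else 0) + 6 * X $ (k - i))) = eulerE 3 $ k + 6 * (eulerE 3 * X) $ k"
      unfolding distrib_left sum.distrib Y by simp
    then show "(eulerE 1 ^ 3) $ k = (eulerE 3 * ?V) $ k"
      unfolding * eulerE_nth_dissection(2)[OF w] X_def[symmetric] Y by (simp only:)
  qed
  finally show ?thesis using euler_nonzero(1)[of 3] by (rule mult_left_cancel[THEN iffD1, rotated])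
qed

text \<open>The weights 6 and -3 are -3 times the factors -2 and 1 in \<open>lambda\<close>; in
  residue 2 both sides vanish, as the character sum does.\<close>

lemma C_at_root3:
  assumes w: "w\<^sup>2 + w + 1 = 0" and n: "n \<ge> 1"
  shows "C_at n w = - 3 * of_int (lambda n) * w ^ n"
proof -
  have w0: "w \<noteq> 0" using w by auto
  have "n mod 3 = 0 \<or> n mod 3 = 1 \<or> n mod 3 = 2" by linarith
  then have "C_series w $ n = - 3 * of_int (lambda n)"
    using n lambda_eq_chi3_sum[of n] chi3_sum_eq_0[of n]
    by (elim disjE) (simp_all add: C_series_root3[OF w] dvd_eq_mod_eq_0)
  then show ?thesis using C_at_eq_nth[OF n w0] by simp
qed

lemma P_at_root3:
  assumes w: "w\<^sup>2 + w + 1 = 0" and n: "n \<ge> 1"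
  shows "P_at n w = of_int (lambda n) * w ^ (n - 1)"
proof -
  obtain m where m: "n = Suc m" using n by (cases n) auto
  have w0: "w \<noteq> 0" using w by auto
  have "(w - 1)\<^sup>2 = (w\<^sup>2 + w + 1) - 3 * w" by (simp add: power2_eq_square algebra_simps)
  then have "P_at n w * (- 3 * w) = C_at n w" using P_at_mult[OF n, of w] w by simp
  also have "\<dots> = (of_int (lambda n) * w ^ m) * (- 3 * w)" unfolding C_at_root3[OF w n] by (simp add: m)
  finally show ?thesis using w0 unfolding m by (subst (asm) mult_right_cancel) auto
qed

theorem theorem1p5:
  fixes n :: nat and j :: complex
  assumes n: "n \<ge> 1"
    and j: "j = exp (2 * of_real pi * \<i> / 3)"
  shows
    "(C_at n (-1) = of_nat (r_count n) \<and> P_at n (-1) = of_nat (r_count n) / 4) \<and>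
     (C_at n j = - 3 * of_int (lambda n) * j ^ n \<and>
      P_at n j = of_int (lambda n) * j ^ (n - 1)) \<and>
     (C_at n \<i> = (-1) ^ ((n + 1) div 2) * of_nat (r'_count n) * \<i> ^ n \<and>
      P_at n \<i> = (-1) ^ ((n - 1) div 2) * (of_nat (r'_count n) / 2) * \<i> ^ (n - 1)) \<and>
     (\<forall>w \<in> {j, - exp (of_real pi * \<i> / 3)}.
        C_at n (- w) =
          (if n mod 3 = 0 then of_nat (r_count n)
           else if n mod 3 = 1 then of_nat (r_count n) / 4 * w
           else - (of_nat (r_count n) / 2) * w ^ 2) \<and>
        P_at n (- w) = C_at n (- w) / w \<and>
        P_at n (- w) = C_at n (- w) * w ^ 2)"
proof -
  define u where "u = exp (of_real pi * \<i> / 3)"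
  have "u ^ 3 = exp (of_real pi * \<i>)"
    unfolding u_def exp_of_nat_mult[symmetric] by simp
  then have u3: "u ^ 3 = -1" by simp
  \<comment> \<open>The real part excludes the root -1 of u^3 + 1, leaving the quadratic
    factor.\<close>
  have "Re u = 1 / 2" by (simp add: u_def Re_exp cos_60)
  then have "u \<noteq> -1" by auto
  moreover have "(u + 1) * (u\<^sup>2 - u + 1) = u ^ 3 + 1"
    by (simp add: power2_eq_square power3_eq_cube algebra_simps)
  then have "(u + 1) * (u\<^sup>2 - u + 1) = 0" using u3 by simp
  ultimately have u: "u\<^sup>2 - u + 1 = 0" by (simp add: eq_neg_iff_add_eq_0)
  have "j = u\<^sup>2" unfolding j u_def exp_double[symmetric] by (simp add: field_simps)
  also have "\<dots> = u - 1" using u by (simp add: algebra_simps eq_neg_iff_add_eq_0)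
  finally have "j = u - 1" .
  have "j\<^sup>2 + j + 1 = u\<^sup>2 - u + 1"
    unfolding \<open>j = u - 1\<close> by (simp add: power2_eq_square algebra_simps)
  then have j: "j\<^sup>2 + j + 1 = 0" using u by simp
  \<comment> \<open>Here -u is the complex conjugate of j, the other primitive cube root of unity;
    so the formulas for -w hold both at -j and at u = exp(pi i / 3).\<close>
  have w: "w\<^sup>2 + w + 1 = 0" if "w \<in> {j, - u}" for w
    using that j u by auto
  have "P_at n (-1) = of_nat (r_count n) / 4"
    using P_at_mult[OF n, of "-1"] C_at_minus_1[OF n] by (simp add: field_simps)
  then show ?thesis
    unfolding u_def[symmetric]
    using C_at_minus_1[OF n] C_at_root3[OF j n] P_at_root3[OF j n] C_at_i[OF n] P_at_i[OF n]
      C_at_minus_root3[OF w n] P_at_minus_root3[OF w n] by blast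
qed

end
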